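(* Let $f, g \in \mathbb{C}[x]$ be two compositionally independent polynomials of degree one, and let $c(x) \in \mathbb{C}[x]$ be any polynomial. Then there is a polynomial $h \in \mathbb{C}[x]$ such that \[ \gcd\big(f^{\circ n}(x) - c(x),\, g^{\circ n}(x) - c(x)\big) \mid h \] for all positive integers $n$.
   Context: For a polynomial $q$, $q^{\circ n}$ denotes the composition of $q$ with itself $n$ times. Two polynomials $f$ and $g$ are called compositionally independent if the semigroup they generate under composition is free on the two generators $f,g$; equivalently, whenever $i_1,\dots,i_s,j_1,\dots,j_s,\ell_1,\dots,\ell_t,m_1,\dots,m_t$ are positive integers with $f^{\circ i_1}\circ g^{\circ j_1}\circ\cdots\circ f^{\circ i_s}\circ g^{\circ j_s} = f^{\circ \ell_1}\circ g^{\circ m_1}\circ\cdots\circ f^{\circ \ell_t}\circ g^{\circ m_t}$, one has $s=t$ and $i_k=\ell_k$, $j_k=m_k$ for all $k$. *)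

theory Defs
  imports
    "HOL-Computational_Algebra.Computational_Algebra"
    "HOL-Computational_Algebra.Field_as_Ring"
begin

definition poly_iter :: "'a::comm_semiring_1 poly \<Rightarrow> nat \<Rightarrow> 'a poly"
  where "poly_iter q n = (pcompose q ^^ n) [:0, 1:]"

(* A word in two letters, True standing for f and False for g, read from left to right:
   [True, False, False] stands for f o g o g. *)

definition word_comp :: "'a::comm_semiring_1 poly \<Rightarrow> 'a poly \<Rightarrow> bool list \<Rightarrow> 'a poly"
  where "word_comp f g w = foldr (\<lambda>b. pcompose (if b then f else g)) w [:0, 1:]"

(* The nonempty words form the free semigroup on two letters, so injectivity of their evaluation
   says that the semigroup generated by f and g under composition is free on f, g.
   Lemma comp_independent_iff_blocks below is the formulation with positive exponents. *)

definition comp_independent :: "'a::comm_semiring_1 poly \<Rightarrow> 'a poly \<Rightarrow> bool"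
  where "comp_independent f g \<longleftrightarrow> inj_on (word_comp f g) {w. w \<noteq> []}"

(* [(i1, j1), ..., (is, js)] stands for f^i1 o g^j1 o ... o f^is o g^js. *)

definition block_comp :: "'a::comm_semiring_1 poly \<Rightarrow> 'a poly \<Rightarrow> (nat \<times> nat) list \<Rightarrow> 'a poly"
  where "block_comp f g xs =
    foldr (\<lambda>(i, j) p. pcompose (poly_iter f i) (pcompose (poly_iter g j) p)) xs [:0, 1:]"

definition pos_blocks :: "(nat \<times> nat) list set"
  where "pos_blocks = {xs. xs \<noteq> [] \<and> (\<forall>(i, j) \<in> set xs. i > 0 \<and> j > 0)}"

definition blocks_word :: "(nat \<times> nat) list \<Rightarrow> bool list"
  where "blocks_word xs = concat (map (\<lambda>(i, j). replicate i True @ replicate j False) xs)"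

lemma pcompose_id_left [simp]: "pcompose [:0, 1:] p = (p :: 'a::comm_semiring_1 poly)"
  by (simp add: pcompose_pCons)

lemma word_comp_Nil [simp]: "word_comp f g [] = [:0, 1:]"
  by (simp add: word_comp_def)

lemma word_comp_Cons [simp]:
  "word_comp f g (b # w) = pcompose (if b then f else g) (word_comp f g w)"
  by (simp add: word_comp_def)

lemma word_comp_append:
  "word_comp f g (v @ w) = pcompose (word_comp f g v) (word_comp f g w)"
  by (induction v) (simp_all add: pcompose_assoc)

lemma word_comp_replicate:
  "word_comp f g (replicate n b) = poly_iter (if b then f else g) n"
  by (induction n) (simp_all add: poly_iter_def)

lemma word_comp_blocks_word: "word_comp f g (blocks_word xs) = block_comp f g xs"
  by (induction xs)
     (auto simp: blocks_word_def block_comp_def word_comp_append word_comp_replicate pcompose_assoc)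

lemma blocks_word_Cons:
  "blocks_word ((i, j) # xs) = replicate i True @ replicate j False @ blocks_word xs"
  by (simp add: blocks_word_def)

lemma blocks_word_hd:
  assumes "\<forall>(i, j) \<in> set xs. i > 0 \<and> j > 0"
  shows "blocks_word xs = [] \<and> xs = [] \<or> (\<exists>w. blocks_word xs = True # w)"
proof (cases xs)
  case (Cons x ys)
  obtain i j where x: "x = (i, j)" by fastforce
  then obtain i' where "i = Suc i'" using assms Cons by (auto dest: gr0_implies_Suc)
  then show ?thesis using Cons x by (simp add: blocks_word_Cons)
qed (simp add: blocks_word_def)

lemma replicate_append_eq:
  assumes "replicate i b @ u = replicate k b @ v"
    and "u = [] \<or> hd u \<noteq> b" "v = [] \<or> hd v \<noteq> b"
  shows "i = k \<and> u = v"
  using assms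
proof (induction i arbitrary: k)
  case 0
  then show ?case by (cases k) auto
next
  case (Suc i)
  then show ?case by (cases k) auto
qed

lemma blocks_word_inj:
  assumes "\<forall>(i, j) \<in> set xs. i > 0 \<and> j > 0" "\<forall>(i, j) \<in> set ys. i > 0 \<and> j > 0"
    and "blocks_word xs = blocks_word ys"
  shows "xs = ys"
  using assms
proof (induction xs arbitrary: ys)
  case Nil
  have "blocks_word ys = []" using Nil.prems(3) by (simp add: blocks_word_def)
  then show ?case using blocks_word_hd[OF Nil.prems(2)] by auto
next
  case (Cons x xs)
  obtain i j where x: "x = (i, j)" by fastforce
  have "blocks_word (x # xs) \<noteq> []" using blocks_word_hd[OF Cons.prems(1)] by auto
  then have "ys \<noteq> []" using Cons.prems(3) by (metis blocks_word_def concat.simps(1) list.map(1))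
  then obtain k l zs where ys: "ys = (k, l) # zs" by (metis list.exhaust surj_pair)
  have pos: "j > 0" "l > 0" using Cons.prems(1,2) x ys by auto
  have hds: "blocks_word xs = [] \<or> hd (blocks_word xs) \<noteq> False"
    "blocks_word zs = [] \<or> hd (blocks_word zs) \<noteq> False"
    using blocks_word_hd[of xs] blocks_word_hd[of zs] Cons.prems(1,2) ys by auto
  have "replicate i True @ (replicate j False @ blocks_word xs)
      = replicate k True @ (replicate l False @ blocks_word zs)"
    using Cons.prems(3) x ys by (simp add: blocks_word_Cons)
  then have 1: "i = k \<and> replicate j False @ blocks_word xs = replicate l False @ blocks_word zs"
    by (rule replicate_append_eq) (use pos in \<open>simp_all add: hd_append\<close>)
  then have 2: "j = l \<and> blocks_word xs = blocks_word zs"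
    using hds by (intro replicate_append_eq[of j False _ l]) simp_all
  then have "xs = zs" using Cons.prems(1,2) ys by (intro Cons.IH) simp_all
  with 1 2 x ys show ?case by simp
qed

lemma blocks_word_surj:
  "\<exists>xs \<in> pos_blocks. blocks_word xs = True # w @ [False]"
proof (induction w rule: length_induct)
  case (1 w)
  have nil: "blocks_word [] = []" by (simp add: blocks_word_def)
  have IH: "\<exists>i j xs. i > 0 \<and> j > 0 \<and> (\<forall>(i, j) \<in> set xs. i > 0 \<and> j > 0) \<and>
      blocks_word ((i, j) # xs) = True # v @ [False]" if len: "length v < length w" for v
  proof -
    obtain ys where ys: "ys \<in> pos_blocks" "blocks_word ys = True # v @ [False]"
      using 1 len by blast
    then obtain i j xs where "ys = (i, j) # xs"
      by (cases ys) (auto simp: pos_blocks_def)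
    with ys show ?thesis by (auto simp: pos_blocks_def)
  qed
  consider "w = []" | v where "w = True # v" | "w = [False]"
    | v where "w = False # True # v" | v where "w = False # False # v"
    by (metis (full_types) list.exhaust)
  then show ?case
  proof cases
    case 1
    then show ?thesis
      by (intro bexI[of _ "[(1, 1)]"]) (auto simp: blocks_word_Cons nil pos_blocks_def)
  next
    case (2 v)
    then obtain i j xs where "i > 0" "j > 0" "\<forall>(i, j) \<in> set xs. i > 0 \<and> j > 0"
      "blocks_word ((i, j) # xs) = True # v @ [False]" using IH[of v] by auto
    then show ?thesis using 2
      by (intro bexI[of _ "(Suc i, j) # xs"]) (auto simp: blocks_word_Cons pos_blocks_def)
  next
    case 3
    then show ?thesis
      by (intro bexI[of _ "[(1, 2)]"])
         (auto simp: blocks_word_Cons nil pos_blocks_def numeral_2_eq_2)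
  next
    case (4 v)
    then obtain i j xs where "i > 0" "j > 0" "\<forall>(i, j) \<in> set xs. i > 0 \<and> j > 0"
      "blocks_word ((i, j) # xs) = True # v @ [False]" using IH[of v] by auto
    then show ?thesis using 4
      by (intro bexI[of _ "(1, 1) # (i, j) # xs"]) (auto simp: blocks_word_Cons pos_blocks_def)
  next
    case (5 v)
    then obtain i j xs where *: "i > 0" "j > 0" "\<forall>(i, j) \<in> set xs. i > 0 \<and> j > 0"
      "blocks_word ((i, j) # xs) = True # False # v @ [False]" using IH[of "False # v"] by auto
    then have "i = 1"
      by (cases i; cases "i - 1") (auto simp: blocks_word_Cons)
    then show ?thesis using 5 *
      by (intro bexI[of _ "(1, Suc j) # xs"]) (auto simp: blocks_word_Cons pos_blocks_def)
  qed
qed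

lemma comp_independent_iff_blocks:
  "comp_independent f g \<longleftrightarrow>
    (\<forall>xs \<in> pos_blocks. \<forall>ys \<in> pos_blocks. block_comp f g xs = block_comp f g ys \<longrightarrow> xs = ys)"
proof
  assume ind: "comp_independent f g"
  show "\<forall>xs \<in> pos_blocks. \<forall>ys \<in> pos_blocks. block_comp f g xs = block_comp f g ys \<longrightarrow> xs = ys"
  proof (intro ballI impI)
    fix xs ys assume *: "xs \<in> pos_blocks" "ys \<in> pos_blocks"
      and eq: "block_comp f g xs = block_comp f g ys"
    have "blocks_word xs \<noteq> []" "blocks_word ys \<noteq> []"
      using * blocks_word_hd[of xs] blocks_word_hd[of ys] by (auto simp: pos_blocks_def)
    then have "blocks_word xs = blocks_word ys"
      using ind eq by (auto simp: comp_independent_def inj_on_def word_comp_blocks_word)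
    then show "xs = ys" using * by (auto simp: pos_blocks_def intro: blocks_word_inj)
  qed
next
  assume blocks: "\<forall>xs \<in> pos_blocks. \<forall>ys \<in> pos_blocks.
    block_comp f g xs = block_comp f g ys \<longrightarrow> xs = ys"
  show "comp_independent f g"
    unfolding comp_independent_def
  proof (rule inj_onI)
    fix v w assume eq: "word_comp f g v = word_comp f g w"
    obtain xs ys where *: "xs \<in> pos_blocks" "blocks_word xs = True # v @ [False]"
      "ys \<in> pos_blocks" "blocks_word ys = True # w @ [False]"
      using blocks_word_surj by metis
    have "block_comp f g xs = block_comp f g ys"
      using eq by (simp add: * word_comp_append flip: word_comp_blocks_word)
    then have "xs = ys" using blocks * by blast
    then show "v = w" using * by simp
  qed
qed

end

theory Submission
  imports Defs
begin

text \<open>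
  The gcd divides the difference of the \<open>n\<close>-th iterates of \<open>f\<close> and \<open>g\<close>, which has degree at most 1
  and is not zero. So it suffices that only finitely many points \<open>x\<close> satisfy
  \<open>f\<^sup>n(x) = g\<^sup>n(x) = c(x)\<close> for some \<open>n > 0\<close>. Write \<open>f\<^sup>n(x) = a\<^sup>n (x - p) + p\<close> and
  \<open>g\<^sup>n(x) = b\<^sup>n (x - q) + q\<close>; here \<open>p \<noteq> q\<close> and \<open>a, b\<close> are not roots of unity. The point \<open>x\<close> is
  determined by \<open>n\<close>, and eliminating it gives a polynomial relation \<open>F(a\<^sup>n, b\<^sup>n) = 0\<close>. If \<open>a, b\<close> are
  multiplicatively independent, infinitely many solutions contradict the Skolem-Mahler-Lech theorem.
  Otherwise \<open>a\<^sup>i = b\<^sup>j\<close> or \<open>a\<^sup>i b\<^sup>j = 1\<close> turns into a polynomial identity for \<open>c\<close>, which is only possible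
  for \<open>c = x\<close> (harmless) or for \<open>c = p + q - x\<close> and \<open>i = j\<close>; in the latter case \<open>f\<^sup>i g\<^sup>i\<close> and
  \<open>g\<^sup>i f\<^sup>i\<close> are translations, which commute. A translation \<open>f\<close> or \<open>g\<close> is treated in the same way,
  with \<open>F(a\<^sup>n, n) = 0\<close>.

  The Skolem-Mahler-Lech theorem is proved for all fields of characteristic 0 by Hansel's method:
  along a suitable progression the sequence has the form \<open>\<Sum>\<^sub>j (m choose j) p\<^sup>j d\<^sub>j\<close>, and such a sequence
  with infinitely many zeros is divisible by every power of \<open>p\<close>.
\<close>

section \<open>Subrings and simple extensions\<close>

definition is_subring :: "'a::ring_1 set \<Rightarrow> bool"
  where "is_subring R \<longleftrightarrow> 1 \<in> R \<and> (\<forall>x\<in>R. \<forall>y\<in>R. x - y \<in> R \<and> x * y \<in> R)"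

definition is_subfield :: "'a::field set \<Rightarrow> bool"
  where "is_subfield K \<longleftrightarrow> is_subring K \<and> (\<forall>x\<in>K. inverse x \<in> K)"

definition poly_over :: "'a::zero set \<Rightarrow> 'a poly set"
  where "poly_over R = {q. \<forall>i. coeff q i \<in> R}"

lemma is_subfieldD: "is_subfield K \<Longrightarrow> is_subring K"
  by (simp add: is_subfield_def)

context
  fixes R :: "'a::ring_1 set"
  assumes R: "is_subring R"
begin

lemma subring_1: "1 \<in> R" and subring_diff: "x \<in> R \<Longrightarrow> y \<in> R \<Longrightarrow> x - y \<in> R"
  and subring_mult: "x \<in> R \<Longrightarrow> y \<in> R \<Longrightarrow> x * y \<in> R"
  using R by (auto simp: is_subring_def)

lemma subring_0: "0 \<in> R"
  using subring_diff[OF subring_1 subring_1] by simp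

lemma subring_uminus: "x \<in> R \<Longrightarrow> - x \<in> R"
  using subring_diff[OF subring_0] by fastforce

lemma subring_add: "x \<in> R \<Longrightarrow> y \<in> R \<Longrightarrow> x + y \<in> R"
  using subring_diff[of x "- y"] subring_uminus by simp

lemma subring_sum: "(\<And>i. i \<in> I \<Longrightarrow> f i \<in> R) \<Longrightarrow> sum f I \<in> R"
  by (induction I rule: infinite_finite_induct) (auto intro: subring_0 subring_add)

lemma subring_power: "x \<in> R \<Longrightarrow> x ^ n \<in> R"
  by (induction n) (auto intro: subring_1 subring_mult)

lemma subring_of_nat: "of_nat n \<in> R"
  by (induction n) (auto intro: subring_0 subring_1 subring_add)

lemma subring_of_int: "of_int n \<in> R"
  by (cases n) (auto intro: subring_of_nat subring_uminus simp del: of_nat_Suc)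

end

context
  fixes R :: "'a::comm_ring_1 set"
  assumes R: "is_subring R"
begin

lemma poly_over_pCons: "pCons c q \<in> poly_over R \<longleftrightarrow> c \<in> R \<and> q \<in> poly_over R"
  by (auto simp: poly_over_def coeff_pCons split: nat.splits)

lemma poly_over_0: "0 \<in> poly_over R"
  using subring_0[OF R] by (simp add: poly_over_def)

lemma is_subring_poly_over: "is_subring (poly_over R)"
  by (auto simp: is_subring_def poly_over_def coeff_mult coeff_pCons simp flip: pCons_one split: nat.splits
      intro: subring_0[OF R] subring_1[OF R] subring_diff[OF R] intro!: subring_sum[OF R] subring_mult[OF R])

lemma poly_over_smult: "c \<in> R \<Longrightarrow> q \<in> poly_over R \<Longrightarrow> smult c q \<in> poly_over R"
  using subring_mult[OF R] by (simp add: poly_over_def)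

lemma poly_over_monom: "c \<in> R \<Longrightarrow> monom c n \<in> poly_over R"
  using subring_0[OF R] by (simp add: poly_over_def)

lemma poly_over_poly: "q \<in> poly_over R \<Longrightarrow> x \<in> R \<Longrightarrow> poly q x \<in> R"
  by (induction q) (auto simp: poly_over_pCons subring_0[OF R] intro!: subring_add[OF R] subring_mult[OF R])

lemma poly_over_pcompose: "q \<in> poly_over R \<Longrightarrow> r \<in> poly_over R \<Longrightarrow> pcompose q r \<in> poly_over R"
proof (induction q)
  case (pCons c q)
  then show ?case using is_subring_poly_over
    by (auto simp: poly_over_pCons pcompose_pCons poly_over_0 intro!: subring_add subring_mult)
qed (simp add: poly_over_0)

text \<open>Subtracting \<open>P * t\<close>, with \<open>t\<close> the monomial matching the
  leading terms, cancels the leading term of \<open>q\<close>. Since \<open>P\<close> is monic, no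
  division in \<open>R\<close> is needed, so everything stays over the subring.\<close>

lemma poly_over_divide_monic:
  assumes "q \<in> poly_over R" "P \<in> poly_over R" "lead_coeff P = 1" "degree P > 0"
  shows "\<exists>s\<in>poly_over R. \<exists>r\<in>poly_over R. q = P * s + r \<and> degree r < degree P"
  using assms(1)
proof (induction "degree q" arbitrary: q rule: less_induct)
  case less
  note S = is_subring_poly_over
  show ?case
  proof (cases "degree q < degree P")
    case True
    then show ?thesis using less.prems poly_over_0 by (intro bexI[of _ 0] bexI[of _ q]) auto
  next
    case False
    define t where "t = monom (lead_coeff q) (degree q - degree P)"
    define q' where "q' = q - P * t"
    have t: "t \<in> poly_over R"
      using less.prems unfolding t_def by (intro poly_over_monom) (auto simp: poly_over_def)
    have q': "q' \<in> poly_over R"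
      unfolding q'_def using less.prems t assms by (intro subring_diff[OF S] subring_mult[OF S])
    have "degree (P * t) \<le> degree q"
      using degree_mult_le[of P t] degree_monom_le[of "lead_coeff q" "degree q - degree P"] False
      by (simp add: t_def)
    then have le: "degree q' \<le> degree q" by (simp add: q'_def degree_diff_le)
    have "coeff (P * t) (degree q) = lead_coeff q"
      using False assms(3,4) coeff_mult_degree_sum[of P t]
      by (cases "q = 0") (auto simp: t_def degree_monom_eq)
    then have 0: "coeff q' (degree q) = 0" by (simp add: q'_def)
    have "degree q' < degree q"
    proof (cases "degree q' = degree q")
      case True
      then have "q' = 0" using 0 by (metis leading_coeff_0_iff)
      then show ?thesis using True False assms(4) by simp
    qed (use le in simp)
    from less.hyps[OF this q'] obtain s r where "s \<in> poly_over R" "r \<in> poly_over R"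
      "q' = P * s + r" "degree r < degree P" by blast
    then show ?thesis using t
      by (intro bexI[of _ "s + t"] bexI[of _ r]) (auto simp: q'_def algebra_simps intro: subring_add[OF S])
  qed
qed

end

lemma poly_over_mono: "R \<subseteq> R' \<Longrightarrow> poly_over R \<subseteq> poly_over R'"
  by (auto simp: poly_over_def)

lemma coeffs_poly_over:
  assumes "is_subring R" "set (coeffs q) \<subseteq> R"
  shows "q \<in> poly_over R"
proof -
  have "range (coeff q) \<subseteq> R"
    using range_coeff[of q] subring_0[OF assms(1)] assms(2) by simp
  then show ?thesis by (auto simp: poly_over_def)
qed

lemma poly_over_coeffs:
  assumes "q \<in> poly_over R"
  shows "set (coeffs q) \<subseteq> R"
proof -
  have "range (coeff q) \<subseteq> R" using assms by (auto simp: poly_over_def)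
  then show ?thesis by (simp add: range_coeff)
qed

text \<open>For a subfield \<open>K\<close> this is K(x) inside the ambient field, whether
  \<open>x\<close> is algebraic or transcendental over \<open>K\<close>.\<close>

definition adjoin :: "'a::field set \<Rightarrow> 'a \<Rightarrow> 'a set"
  where "adjoin K x = {poly F x / poly G x |F G. F \<in> poly_over K \<and> G \<in> poly_over K \<and> poly G x \<noteq> 0}"

lemma adjoinI:
  "F \<in> poly_over K \<Longrightarrow> G \<in> poly_over K \<Longrightarrow> poly G x \<noteq> 0 \<Longrightarrow> poly F x / poly G x \<in> adjoin K x"
  unfolding adjoin_def by blast

lemma is_subfield_adjoin:
  assumes "is_subfield K"
  shows "is_subfield (adjoin K x)"
proof -
  have K: "is_subring K" using assms by (rule is_subfieldD)
  note S = is_subring_poly_over[OF K]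
  have 1: "1 \<in> adjoin K x"
    using subring_1[OF S] unfolding adjoin_def by (auto intro!: exI[of _ 1])
  have 2: "u - v \<in> adjoin K x \<and> u * v \<in> adjoin K x" if uv: "u \<in> adjoin K x" "v \<in> adjoin K x" for u v
  proof -
    obtain F G F' G' where *: "u = poly F x / poly G x" "F \<in> poly_over K" "G \<in> poly_over K" "poly G x \<noteq> 0"
      "v = poly F' x / poly G' x" "F' \<in> poly_over K" "G' \<in> poly_over K" "poly G' x \<noteq> 0"
      using uv unfolding adjoin_def by auto
    have "u - v = poly (F * G' - F' * G) x / poly (G * G') x" "u * v = poly (F * F') x / poly (G * G') x"
      using *(4,8) unfolding *(1,5) by (simp_all add: field_simps)
    moreover have "F * G' - F' * G \<in> poly_over K" "G * G' \<in> poly_over K" "F * F' \<in> poly_over K"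
      using * by (auto intro!: subring_diff[OF S] subring_mult[OF S])
    moreover have "poly (G * G') x \<noteq> 0" using * by simp
    ultimately show ?thesis by (auto simp del: poly_mult poly_diff intro: adjoinI)
  qed
  have 3: "inverse u \<in> adjoin K x" if u: "u \<in> adjoin K x" for u
  proof -
    obtain F G where *: "u = poly F x / poly G x" "F \<in> poly_over K" "G \<in> poly_over K" "poly G x \<noteq> 0"
      using u unfolding adjoin_def by auto
    show ?thesis
    proof (cases "poly F x = 0")
      case True
      then show ?thesis using * u by simp
    next
      case False
      then have "inverse u = poly G x / poly F x" using * by simp
      then show ?thesis using * False unfolding adjoin_def by blast
    qed
  qed
  show ?thesis using 1 2 3 by (simp add: is_subfield_def is_subring_def)
qed

lemma adjoin_polyI:
  assumes "is_subfield K" "F \<in> poly_over K"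
  shows "poly F x \<in> adjoin K x"
proof -
  have "1 \<in> poly_over K" "poly F x = poly F x / poly 1 x" "poly 1 x \<noteq> 0"
    using subring_1[OF is_subring_poly_over[OF is_subfieldD[OF assms(1)]]] by simp_all
  then show ?thesis using assms(2) unfolding adjoin_def by blast
qed

lemma subset_adjoin: assumes "is_subfield K" shows "K \<subseteq> adjoin K x"
proof
  fix y assume "y \<in> K"
  then have "[:y:] \<in> poly_over K"
    using is_subfieldD[OF assms] by (simp add: poly_over_pCons poly_over_0)
  from adjoin_polyI[OF assms this, of x] show "y \<in> adjoin K x" by simp
qed

lemma in_adjoin: assumes "is_subfield K" shows "x \<in> adjoin K x"
proof -
  have "[:0, 1:] \<in> poly_over K"
    using is_subfieldD[OF assms] by (simp add: poly_over_pCons poly_over_0 subring_0 subring_1)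
  from adjoin_polyI[OF assms this, of x] show ?thesis by simp
qed

text \<open>Euclid's algorithm: dividing \<open>P\<close> by the monic multiple of \<open>G\<close>
  leaves a remainder \<open>r\<close> of smaller degree whose value at \<open>x\<close> is a
  multiple of \<open>poly G x\<close>; an inverse of the former yields one of the latter.\<close>

lemma poly_over_inverse_mod:
  assumes K: "is_subfield K" and P: "P \<in> poly_over K" "poly P x = 0"
    and min: "\<And>q. q \<in> poly_over K \<Longrightarrow> poly q x = 0 \<Longrightarrow> degree q < degree P \<Longrightarrow> q = 0"
    and G: "G \<in> poly_over K" "poly G x \<noteq> 0" "degree G < degree P"
  shows "\<exists>U\<in>poly_over K. poly U x * poly G x = 1"
  using G
proof (induction "degree G" arbitrary: G rule: less_induct)
  case less
  have R: "is_subring K" using K by (rule is_subfieldD)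
  note S = is_subring_poly_over[OF R]
  have Gn: "G \<noteq> 0" using less.prems by auto
  have lc: "inverse (lead_coeff G) \<in> K" using K less.prems by (simp add: is_subfield_def poly_over_def)
  show ?case
  proof (cases "degree G = 0")
    case True
    then obtain g where "G = [:g:]" by (rule degree_eq_zeroE)
    then show ?thesis using lc Gn
      by (intro bexI[of _ "[:inverse g:]"]) (auto simp: poly_over_pCons[OF R] poly_over_0[OF R])
  next
    case False
    define G' where "G' = smult (inverse (lead_coeff G)) G"
    have G': "G' \<in> poly_over K" "lead_coeff G' = 1" "degree G' = degree G"
      using lc less.prems Gn by (auto simp: G'_def intro: poly_over_smult[OF R])
    obtain s r where sr: "s \<in> poly_over K" "r \<in> poly_over K" "P = G' * s + r" "degree r < degree G'"
      using poly_over_divide_monic[OF R P(1) G'(1,2)] False G' by auto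
    have rx: "poly r x = - (poly s x * inverse (lead_coeff G)) * poly G x"
      using P(2) sr(3) by (simp add: G'_def algebra_simps eq_neg_iff_add_eq_0)
    \<comment> \<open>Otherwise \<open>r = 0\<close> by minimality, so P = G' s; then
      \<open>s\<close>, of lower degree than \<open>P\<close>, vanishes at \<open>x\<close> and is
      zero by minimality as well.\<close>
    have "poly r x \<noteq> 0"
    proof
      assume 0: "poly r x = 0"
      then have "r = 0" using min[of r] sr G' less.prems by simp
      moreover from 0 have "poly s x = 0" using rx less.prems Gn by simp
      moreover have "degree s < degree P"
        using sr(3) \<open>r = 0\<close> G' False degree_mult_eq[of G' s] less.prems by (cases "s = 0") fastforce+
      ultimately have "P = 0" using min[of s] sr by auto
      then show False using less.prems by simp
    qed
    then obtain U where U: "U \<in> poly_over K" "poly U x * poly r x = 1"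
      using less.hyps[of r] sr G' less.prems by auto
    show ?thesis
    proof (intro bexI)
      show "poly (- (U * smult (inverse (lead_coeff G)) s)) x * poly G x = 1"
        using U(2) rx by (simp add: algebra_simps)
      show "- (U * smult (inverse (lead_coeff G)) s) \<in> poly_over K"
        using U sr lc by (intro subring_uminus[OF S] subring_mult[OF S] poly_over_smult[OF R])
    qed
  qed
qed

text \<open>K(x) = K[x]: the denominator is reduced modulo \<open>P\<close> and then replaced by its
  inverse from \<open>poly_over_inverse_mod\<close>.\<close>

lemma adjoin_algebraic:
  assumes K: "is_subfield K" and P: "P \<in> poly_over K" "poly P x = 0" "lead_coeff P = 1" "degree P > 0"
    and min: "\<And>q. q \<in> poly_over K \<Longrightarrow> poly q x = 0 \<Longrightarrow> degree q < degree P \<Longrightarrow> q = 0"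
    and s: "s \<in> adjoin K x"
  shows "\<exists>F\<in>poly_over K. s = poly F x"
proof -
  have R: "is_subring K" using K by (rule is_subfieldD)
  note S = is_subring_poly_over[OF R]
  obtain F G where *: "s = poly F x / poly G x" "F \<in> poly_over K" "G \<in> poly_over K" "poly G x \<noteq> 0"
    using s unfolding adjoin_def by auto
  obtain t r where tr: "t \<in> poly_over K" "r \<in> poly_over K" "G = P * t + r" "degree r < degree P"
    using poly_over_divide_monic[OF R *(3) P(1,3,4)] by auto
  have rG: "poly r x = poly G x" using tr P by simp
  then obtain U where "U \<in> poly_over K" "poly U x * poly r x = 1"
    using poly_over_inverse_mod[OF K P(1,2) _ tr(2) _ tr(4)] min *(4) by force
  then have "U \<in> poly_over K" "s = poly (F * U) x"
    using *(4) unfolding *(1) rG by (simp_all add: field_simps)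
  then show ?thesis using *(2) subring_mult[OF S] by blast
qed

section \<open>Separated rings with finite residues\<close>

text \<open>
  An elementary substitute for embedding a finitely generated field into some \<open>\<rat>\<^sub>p\<close>: instead of the
  \<open>p\<close>-adic integers it provides a \<open>p\<close>-adically separated subring \<open>R\<close> of the field itself. The residue
  ring \<open>R/pR\<close> need not be finite, but the image of the subring \<open>A\<close> in it is, so that units of \<open>A\<close>
  have a power congruent to 1 modulo \<open>p\<close>.
\<close>

definition padic_ring :: "nat \<Rightarrow> 'a::field_char_0 set \<Rightarrow> bool"
  where "padic_ring p R \<longleftrightarrow> is_subring R \<and> (\<forall>s::int. \<not> int p dvd s \<longrightarrow> inverse (of_int s) \<in> R) \<and>
    (\<forall>x. (\<forall>i. \<exists>y\<in>R. x = of_nat p ^ i * y) \<longrightarrow> x = 0)"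

definition residually_finite :: "nat \<Rightarrow> 'a::field_char_0 set \<Rightarrow> 'a set \<Rightarrow> bool"
  where "residually_finite p R A \<longleftrightarrow> is_subring A \<and> A \<subseteq> R \<and>
    (\<exists>Y. finite Y \<and> (\<forall>z\<in>A. \<exists>y\<in>Y. \<exists>w\<in>R. z = y + of_nat p * w))"

text \<open>The invariant of the induction on generators. The prime depends on \<open>S\<close>,
  whose denominators it has to avoid; \<open>S\<close> lies in \<open>A\<close>, not only in
  \<open>R\<close>, so that its elements have finitely many residues. \<open>p > 2\<close> serves
  the estimate of factorials.\<close>

definition padic_field :: "'a::field_char_0 set \<Rightarrow> bool"
  where "padic_field K \<longleftrightarrow> is_subfield K \<and> (\<forall>S. finite S \<and> S \<subseteq> K \<longrightarrow>
    (\<exists>p R A. prime p \<and> p > 2 \<and> R \<subseteq> K \<and> S \<subseteq> A \<and> padic_ring p R \<and> residually_finite p R A))"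

lemma padic_ring_sep:
  assumes "padic_ring p R" "\<And>i. \<exists>y\<in>R. x = of_nat p ^ i * y"
  shows "x = 0"
  using assms unfolding padic_ring_def by blast

section \<open>Base case: the rational numbers\<close>

text \<open>\<open>loc p\<close> is the localization of the integers at \<open>p\<close>. It serves
  as both \<open>R\<close> and \<open>A\<close>, for a prime larger than all denominators in
  \<open>S\<close>.\<close>

lemma padic_field_rationals:
  "padic_field {of_int m / of_int n |m n. n \<noteq> 0}" (is "padic_field ?Q")
proof -
  define loc :: "nat \<Rightarrow> 'a set" where "loc p = {of_int m / of_int n |m n. \<not> int p dvd n}" for p
  have locI: "of_int m / of_int n \<in> loc p" if "\<not> int p dvd n" for m n p
    using that unfolding loc_def by blast
  have locE: "\<exists>m n. x = of_int m / of_int n \<and> \<not> int p dvd n" if "x \<in> loc p" for x p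
    using that unfolding loc_def by blast
  have sub: "x - y \<in> loc p" and mult: "x * y \<in> loc p" if pxy: "prime p" "x \<in> loc p" "y \<in> loc p" for x y p
  proof -
    obtain m n m' n' where *: "x = of_int m / of_int n" "\<not> int p dvd n" "y = of_int m' / of_int n'" "\<not> int p dvd n'"
      using locE[OF pxy(2)] locE[OF pxy(3)] by blast
    have "\<not> int p dvd n * n'" using * pxy(1) by (simp add: prime_dvd_mult_iff)
    moreover have "n \<noteq> 0" "n' \<noteq> 0" using * by auto
    then have "x - y = of_int (m * n' - m' * n) / of_int (n * n')" "x * y = of_int (m * m') / of_int (n * n')"
      by (simp_all add: * field_simps)
    ultimately show "x - y \<in> loc p" "x * y \<in> loc p" using locI by metis+
  qed
  have int_loc: "of_int m \<in> loc p" if "prime p" for m p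
    using locI[of p 1 m] prime_gt_1_nat[OF that] by auto
  have ring: "is_subring (loc p)" if "prime p" for p
    using sub mult int_loc[of p 1] that by (auto simp: is_subring_def)
  have sub_loc: "loc p \<subseteq> ?Q" for p
    unfolding loc_def by (auto intro: dvd_0_right)
  have padic: "padic_ring p (loc p)" if p: "prime p" for p
    unfolding padic_ring_def
  proof (intro conjI allI impI)
    show "inverse (of_int s) \<in> loc p" if "\<not> int p dvd s" for s
      using locI[OF that, of 1] by (simp add: divide_inverse)
  next
    fix x :: 'a assume *: "\<forall>i. \<exists>y\<in>loc p. x = of_nat p ^ i * y"
    then have "x \<in> loc p" by (metis mult_1 power_0)
    then obtain m n where mn: "x = of_int m / of_int n" "\<not> int p dvd n" using locE by blast
    have "int p ^ i dvd m" for i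
    proof -
      obtain y where "y \<in> loc p" "x = of_nat p ^ i * y" using * by blast
      then obtain m' n' where mn': "x = of_nat p ^ i * (of_int m' / of_int n')" "\<not> int p dvd n'"
        using locE by blast
      have "n \<noteq> 0" "n' \<noteq> 0" using mn mn' by auto
      then have "(of_int (m * n') :: 'a) = of_int (int p ^ i * m' * n)"
        using mn mn' by (simp add: field_simps)
      then have "m * n' = int p ^ i * m' * n" by (simp only: of_int_eq_iff)
      then have "int p ^ i dvd m * n'" by simp
      moreover have "coprime (int p ^ i) n'"
        using p mn' by (simp add: prime_imp_coprime)
      ultimately show ?thesis by (simp add: coprime_dvd_mult_left_iff)
    qed
    moreover have "finite {i. int p ^ i dvd m}" if "m \<noteq> 0"
      using that prime_gt_1_nat[OF p] by (intro finite_divisor_powers) auto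
    ultimately show "x = 0" using mn by (cases "m = 0") auto
  qed (rule ring[OF p])
  have fin: "residually_finite p (loc p) (loc p :: 'a set)" if p: "prime p" for p
    unfolding residually_finite_def
  proof (intro conjI exI[of _ "of_int ` {0..<int p}"] ballI)
    fix z :: 'a assume "z \<in> loc p"
    then obtain m n where mn: "z = of_int m / of_int n" "\<not> int p dvd n" using locE by blast
    \<comment> \<open>\<open>n'\<close> is an inverse of \<open>n\<close> modulo \<open>p\<close>,
      so \<open>m / n\<close> has the residue of \<open>m * n'\<close>.\<close>
    have "coprime n (int p)" using p mn(2) prime_imp_coprime[of "int p" n] by (simp add: coprime_commute)
    then obtain n' k where "n' * n + k * int p = 1" using bezout_int[of n "int p"] by auto
    then have k: "1 - n * n' = int p * k" by (simp add: algebra_simps)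
    have n0: "n \<noteq> 0" using mn by auto
    define r where "r = (m * n') mod int p"
    define l where "l = (m * n') div int p"
    have rl: "m * n' = int p * l + r" by (simp add: r_def l_def)
    have eq: "m = r * n + int p * (l * n + m * k)"
    proof -
      have "m = m * (1 - n * n') + (m * n') * n" by (simp add: algebra_simps)
      also have "\<dots> = r * n + int p * (l * n + m * k)" unfolding k rl by (simp add: algebra_simps)
      finally show ?thesis .
    qed
    have "z = of_int (r * n + int p * (l * n + m * k)) / of_int n" using eq mn by simp
    also have "\<dots> = of_int r + of_nat p * (of_int (l * n + m * k) / of_int n)"
      using n0 by (simp add: field_simps)
    finally have "z = of_int r + of_nat p * (of_int (l * n + m * k) / of_int n)" .
    moreover have "r \<in> {0..<int p}" using prime_gt_0_nat[OF p] by (simp add: r_def)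
    ultimately show "\<exists>y\<in>of_int ` {0..<int p}. \<exists>w\<in>loc p. z = y + of_nat p * w"
      using locI[OF mn(2)] by blast
  qed (use ring[OF p] in auto)
  show ?thesis
    unfolding padic_field_def
  proof (intro conjI allI impI)
    have "u - v \<in> ?Q \<and> u * v \<in> ?Q" if uv: "u \<in> ?Q" "v \<in> ?Q" for u v
    proof -
      obtain m n m' n' where *: "u = of_int m / of_int n" "n \<noteq> 0" "v = of_int m' / of_int n'" "n' \<noteq> 0"
        using uv by auto
      then have "u - v = of_int (m * n' - m' * n) / of_int (n * n')" "u * v = of_int (m * m') / of_int (n * n')"
        "n * n' \<noteq> 0" unfolding *(1,3) by (simp_all add: field_simps)
      then show ?thesis by blast
    qed
    moreover have "1 \<in> ?Q" by (auto intro!: exI[of _ 1])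
    moreover have "inverse u \<in> ?Q" if u: "u \<in> ?Q" for u
    proof -
      obtain m n where *: "u = of_int m / of_int n" "n \<noteq> 0" using u by auto
      show ?thesis
      proof (cases "m = 0")
        case True then show ?thesis using * u by simp
      next
        case False
        moreover have "inverse u = of_int n / of_int m" by (simp add: *)
        ultimately show ?thesis by blast
      qed
    qed
    ultimately show "is_subfield ?Q" by (simp add: is_subfield_def is_subring_def)
  next
    fix S :: "'a set" assume S: "finite S \<and> S \<subseteq> ?Q"
    then have "\<forall>s\<in>S. \<exists>n. n \<noteq> 0 \<and> (\<exists>m. s = of_int m / of_int n)" by blast
    then obtain n where n: "\<And>s. s \<in> S \<Longrightarrow> n s \<noteq> 0 \<and> (\<exists>m. s = of_int m / of_int (n s))" by metis
    \<comment> \<open>The entry 2 keeps the set nonempty and forces \<open>p > 2\<close>.\<close>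
    obtain p where p: "prime p" "p > Max (insert 2 ((\<lambda>s. nat \<bar>n s\<bar>) ` S))"
      using bigger_prime by blast
    then have p2: "p > 2" and big: "\<And>s. s \<in> S \<Longrightarrow> p > nat \<bar>n s\<bar>" using S by auto
    have ndvd: "\<not> int p dvd n s" if "s \<in> S" for s
      using n[OF that] big[OF that] zdvd_not_zless[of "\<bar>n s\<bar>" "int p"] by auto
    have "S \<subseteq> loc p"
    proof
      fix s assume s: "s \<in> S"
      then obtain m where "s = of_int m / of_int (n s)" using n by blast
      then show "s \<in> loc p" using locI[OF ndvd[OF s], of m] by simp
    qed
    then show "\<exists>p R A. prime p \<and> p > 2 \<and> R \<subseteq> ?Q \<and> S \<subseteq> A \<and> padic_ring p R \<and> residually_finite p R A"
      using p(1) p2 sub_loc padic[OF p(1)] fin[OF p(1)]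
      by (intro exI[of _ p] exI[of _ "loc p"] conjI)
  qed
qed

section \<open>Algebraic extensions\<close>

text \<open>The rings are R[x] and A[x], where \<open>A\<close> contains the coefficients of the
  monic minimal polynomial \<open>P\<close>. Each element has a representative of degree below that
  of \<open>P\<close>, unique by minimality, so separation and finiteness of residues can be read
  off from coefficients.\<close>

lemma padic_field_adjoin_algebraic:
  assumes K: "padic_field K" and ex: "\<exists>P\<in>poly_over K. P \<noteq> 0 \<and> poly P x = 0"
  shows "padic_field (adjoin K x)"
  unfolding padic_field_def
proof (intro conjI allI impI)
  have Kf: "is_subfield K" using K by (simp add: padic_field_def)
  then have Kr: "is_subring K" by (rule is_subfieldD)
  show "is_subfield (adjoin K x)" using Kf by (rule is_subfield_adjoin)
  fix S assume S: "finite S \<and> S \<subseteq> adjoin K x"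
  obtain P0 where P0: "P0 \<in> poly_over K" "P0 \<noteq> 0" "poly P0 x = 0"
    and least: "\<And>q. q \<in> poly_over K \<and> q \<noteq> 0 \<and> poly q x = 0 \<Longrightarrow> degree P0 \<le> degree q"
    using ex ex_has_least_nat[of "\<lambda>q. q \<in> poly_over K \<and> q \<noteq> 0 \<and> poly q x = 0" _ degree] by metis
  define P where "P = smult (inverse (lead_coeff P0)) P0"
  have P: "P \<in> poly_over K" "poly P x = 0" "lead_coeff P = 1" "degree P = degree P0"
    using P0 Kf by (auto simp: P_def is_subfield_def poly_over_def intro: subring_mult[OF Kr])
  have deg: "degree P > 0"
    using P by (metis degree_eq_zeroE gr0I lead_coeff_pCons(2) poly_const_conv zero_neq_one)
  have min: "q = 0" if "q \<in> poly_over K" "poly q x = 0" "degree q < degree P" for q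
    using least[of q] that P(4) by fastforce
  have "\<forall>s\<in>S. \<exists>F\<in>poly_over K. s = poly F x"
    using adjoin_algebraic[OF Kf P(1,2,3) deg min] S by blast
  then obtain F where F: "\<And>s. s \<in> S \<Longrightarrow> F s \<in> poly_over K \<and> s = poly (F s) x" by metis
  \<comment> \<open>The coefficients of \<open>P\<close> are included so that division by
    \<open>P\<close> works over \<open>A\<close> and over \<open>R\<close>.\<close>
  define S' where "S' = set (coeffs P) \<union> (\<Union>s\<in>S. set (coeffs (F s)))"
  have "finite S'" using S by (simp add: S'_def)
  moreover have "S' \<subseteq> K"
    using poly_over_coeffs[OF P(1)] poly_over_coeffs F by (auto simp: S'_def)
  ultimately obtain p R A where pRA: "prime p" "p > 2" "R \<subseteq> K" "S' \<subseteq> A"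
    "padic_ring p R" "residually_finite p R A"
    using K unfolding padic_field_def by meson
  have R: "is_subring R" and A: "is_subring A" "A \<subseteq> R"
    using pRA by (auto simp: padic_ring_def residually_finite_def)
  have PA: "P \<in> poly_over A" using pRA by (intro coeffs_poly_over A) (auto simp: S'_def)
  have FA: "F s \<in> poly_over A" if "s \<in> S" for s
    using pRA that by (intro coeffs_poly_over A) (auto simp: S'_def)
  have PR: "P \<in> poly_over R" using PA poly_over_mono[OF A(2)] by blast
  have reduce: "\<exists>r\<in>poly_over B. poly q x = poly r x \<and> degree r < degree P"
    if "is_subring B" "P \<in> poly_over B" "q \<in> poly_over B" for B q
    using poly_over_divide_monic[OF that(1,3,2) P(3) deg] P(2) by fastforce
  define R' where "R' = (\<lambda>q. poly q x) ` poly_over R"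
  define A' where "A' = (\<lambda>q. poly q x) ` poly_over A"
  have ring: "is_subring ((\<lambda>q. poly q x) ` poly_over B)" if "is_subring B" for B
  proof -
    note PB = is_subring_poly_over[OF that]
    have "poly q x - poly r x \<in> (\<lambda>q. poly q x) ` poly_over B" "poly q x * poly r x \<in> (\<lambda>q. poly q x) ` poly_over B"
      if "q \<in> poly_over B" "r \<in> poly_over B" for q r
      using subring_diff[OF PB that] subring_mult[OF PB that] by (metis image_eqI poly_diff poly_mult)+
    moreover have "1 \<in> (\<lambda>q. poly q x) ` poly_over B"
      using subring_1[OF PB] by (metis image_eqI poly_1)
    ultimately show ?thesis by (auto simp: is_subring_def)
  qed
  have R'_ring: "is_subring R'" and A'_ring: "is_subring A'"
    using ring R A by (auto simp: R'_def A'_def)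
  have emb: "R \<subseteq> R'"
  proof
    fix z assume "z \<in> R"
    then have "[:z:] \<in> poly_over R" by (simp add: poly_over_pCons[OF R] poly_over_0[OF R])
    then have "poly [:z:] x \<in> R'" unfolding R'_def by (rule imageI)
    then show "z \<in> R'" by simp
  qed
  have "padic_ring p R'"
    unfolding padic_ring_def
  proof (intro conjI allI impI)
    show "inverse (of_int s) \<in> R'" if "\<not> int p dvd s" for s
      using that pRA(5) emb by (auto simp: padic_ring_def)
  next
    fix z assume z: "\<forall>i. \<exists>y\<in>R'. z = of_nat p ^ i * y"
    then have "z \<in> R'" by (metis mult_1 power_0)
    then obtain q where q: "q \<in> poly_over R" "z = poly q x" "degree q < degree P"
      using reduce[OF R PR] unfolding R'_def by blast
    have "coeff q j = 0" for j
    proof (rule padic_ring_sep[OF pRA(5)])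
      fix i
      obtain y where "y \<in> R'" "z = of_nat p ^ i * y" using z by blast
      then obtain r where r: "r \<in> poly_over R" "z = of_nat p ^ i * poly r x" "degree r < degree P"
        using reduce[OF R PR] unfolding R'_def by fastforce
      \<comment> \<open>Two representatives of degree below \<open>degree P\<close> with the same
        value at \<open>x\<close> coincide.\<close>
      have "q - smult (of_nat p ^ i) r = 0"
      proof (rule min)
        have "smult (of_nat p ^ i) r \<in> poly_over R"
          using r(1) by (intro poly_over_smult R subring_power subring_of_nat)
        then have "q - smult (of_nat p ^ i) r \<in> poly_over R"
          using q(1) by (intro subring_diff is_subring_poly_over R)
        then show "q - smult (of_nat p ^ i) r \<in> poly_over K" using poly_over_mono[OF pRA(3)] by blast
        show "poly (q - smult (of_nat p ^ i) r) x = 0" using q r by simp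
        show "degree (q - smult (of_nat p ^ i) r) < degree P"
          using q(3) r(3) by (intro degree_diff_less) (auto intro: le_less_trans[OF degree_smult_le])
      qed
      then have "coeff q j = of_nat p ^ i * coeff r j" by (metis coeff_smult eq_iff_diff_eq_0)
      then show "\<exists>y\<in>R. coeff q j = of_nat p ^ i * y" using r(1) by (auto simp: poly_over_def)
    qed
    then have "q = 0" by (simp add: poly_eq_iff)
    then show "z = 0" using q by simp
  qed (rule R'_ring)
  moreover have "residually_finite p R' A'"
  proof -
    obtain Y where Y: "finite Y" "\<And>z. z \<in> A \<Longrightarrow> \<exists>y\<in>Y. \<exists>w\<in>R. z = y + of_nat p * w"
      using pRA(6) unfolding residually_finite_def by blast
    define D where "D = {..<degree P}"
    \<comment> \<open>One residue representative is chosen for each power of \<open>x\<close>;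
      \<open>restrict\<close> below makes the choice extensional, as \<open>PiE\<close>
      requires.\<close>
    define Y' where "Y' = (\<lambda>y. \<Sum>i\<in>D. y i * x ^ i) ` (PiE D (\<lambda>_. Y))"
    have "finite Y'" using Y(1) unfolding Y'_def D_def by (intro finite_imageI finite_PiE) auto
    moreover have "\<exists>y\<in>Y'. \<exists>w\<in>R'. z = y + of_nat p * w" if z: "z \<in> A'" for z
    proof -
      obtain q where q: "q \<in> poly_over A" "z = poly q x" "degree q < degree P"
        using reduce[OF A(1) PA] z unfolding A'_def by blast
      have "\<forall>i. \<exists>y\<in>Y. \<exists>w\<in>R. coeff q i = y + of_nat p * w"
        using Y(2) q(1) by (auto simp: poly_over_def)
      then obtain y w where yw: "\<And>i. y i \<in> Y" "\<And>i. w i \<in> R" "\<And>i. coeff q i = y i + of_nat p * w i"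
        by metis
      have "poly q x = (\<Sum>i\<in>D. coeff q i * x ^ i)"
        unfolding poly_altdef D_def using q(3)
        by (intro sum.mono_neutral_left) (auto simp: coeff_eq_0)
      also have "\<dots> = (\<Sum>i\<in>D. restrict y D i * x ^ i) + of_nat p * (\<Sum>i\<in>D. w i * x ^ i)"
        by (simp add: yw(3) algebra_simps sum.distrib sum_distrib_left)
      finally have "z = (\<Sum>i\<in>D. restrict y D i * x ^ i) + of_nat p * (\<Sum>i\<in>D. w i * x ^ i)"
        using q by simp
      moreover have "(\<Sum>i\<in>D. restrict y D i * x ^ i) \<in> Y'"
        unfolding Y'_def using yw(1) by (intro imageI) auto
      moreover have "(\<Sum>i\<in>D. w i * x ^ i) \<in> R'"
      proof (intro subring_sum[OF R'_ring] subring_mult[OF R'_ring] subring_power[OF R'_ring])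
        show "w i \<in> R'" for i using yw(2) emb by auto
        have "[:0, 1:] \<in> poly_over R"
          by (simp add: poly_over_pCons[OF R] poly_over_0[OF R] subring_0[OF R] subring_1[OF R])
        moreover have "poly [:0, 1:] x = x" by simp
        ultimately show "x \<in> R'" unfolding R'_def by (metis image_eqI)
      qed
      ultimately show ?thesis by blast
    qed
    moreover have "A' \<subseteq> R'" using poly_over_mono[OF A(2)] by (auto simp: A'_def R'_def)
    ultimately show ?thesis using A'_ring unfolding residually_finite_def by blast
  qed
  moreover have "R' \<subseteq> adjoin K x"
    using poly_over_mono[OF pRA(3)] adjoin_polyI[OF Kf] by (auto simp: R'_def)
  moreover have "S \<subseteq> A'" using F FA by (auto simp: A'_def)
  ultimately show "\<exists>p R A. prime p \<and> p > 2 \<and> R \<subseteq> adjoin K x \<and> S \<subseteq> A \<and> padic_ring p R \<and> residually_finite p R A"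
    using pRA(1,2) by blast
qed

section \<open>Transcendental extensions\<close>

text \<open>First-order expansion around \<open>t\<close> by Horner's rule: modulo \<open>p\<close>
  the value no longer depends on \<open>T\<close>.\<close>

lemma poly_affine_expansion:
  fixes t :: "'a::comm_ring_1"
  assumes R: "is_subring R" "q \<in> poly_over R" "t \<in> R"
  shows "\<exists>q'\<in>poly_over R. \<forall>T. poly q (t + of_nat p * T) = poly q t + of_nat p * poly q' T"
  using assms(2)
proof (induction q)
  case 0
  then show ?case using poly_over_0[OF R(1)] by (intro bexI[of _ 0]) auto
next
  case (pCons c q)
  then have q: "q \<in> poly_over R" by (simp add: poly_over_pCons[OF R(1)])
  then obtain q' where q': "q' \<in> poly_over R"
    "\<And>T. poly q (t + of_nat p * T) = poly q t + of_nat p * poly q' T"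
    using pCons.IH by blast
  show ?case
  proof (intro bexI allI)
    \<comment> \<open>In c + (t + p T) (q(t) + p q'(T)), the terms besides c + t q(t) are p times T
      (q(t) + p q'(T)) + t q'(T).\<close>
    show "poly (pCons c q) (t + of_nat p * T)
      = poly (pCons c q) t + of_nat p * poly (pCons 0 ([:poly q t:] + smult (of_nat p) q') + smult t q') T" for T
      by (simp only: poly_pCons poly_add poly_smult q'(2)) (simp add: algebra_simps)
    show "pCons 0 ([:poly q t:] + smult (of_nat p) q') + smult t q' \<in> poly_over R"
      using q q'(1) R
      by (auto simp: poly_over_pCons poly_over_0 subring_0 intro!: subring_add[OF is_subring_poly_over]
          poly_over_smult poly_over_poly subring_of_nat)
  qed
qed

text \<open>Otherwise \<open>- g\<close> would be an inverse of \<open>p\<close>, and 1 would be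
  divisible by every power of \<open>p\<close>.\<close>

lemma padic_ring_no_inverse:
  assumes "padic_ring p R" "g \<in> R"
  shows "1 + of_nat p * g \<noteq> 0"
proof
  assume 0: "1 + of_nat p * g = 0"
  have R: "is_subring R" using assms by (simp add: padic_ring_def)
  have "1 = of_nat p * - g" using 0 by (simp add: eq_neg_iff_add_eq_0)
  then have "1 = of_nat p ^ i * (- g) ^ i" for i by (metis power_mult_distrib power_one)
  moreover have "(- g) ^ i \<in> R" for i using R assms(2) by (intro subring_power subring_uminus)
  ultimately have "(1::'a) = 0" by (intro padic_ring_sep[OF assms(1)]) blast
  then show False by simp
qed

text \<open>Modulo m^i the factor 1 + m b is inverted by the truncated geometric series in u = - m
  b, so it cancels even if it is not a unit of \<open>R\<close>.\<close>

lemma dvd_mod_unit: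
  assumes R: "is_subring R" and ab: "b \<in> R" "c \<in> R" "a \<in> R"
    and eq: "a * (1 + m * b) = m ^ i * c" and m: "m \<in> R"
  shows "\<exists>y\<in>R. a = m ^ i * (y :: 'a::comm_ring_1)"
proof -
  define u where "u = - (m * b)"
  have "a * (1 - u ^ i) = a * (1 - u) * (\<Sum>j<i. u ^ j)"
    by (simp add: one_diff_power_eq mult.assoc)
  also have "\<dots> = m ^ i * c * (\<Sum>j<i. u ^ j)" using eq by (simp add: u_def)
  finally have "a = m ^ i * (c * (\<Sum>j<i. u ^ j) + a * (- b) ^ i)"
    by (simp add: u_def algebra_simps flip: power_mult_distrib)
  moreover have "c * (\<Sum>j<i. u ^ j) + a * (- b) ^ i \<in> R"
    using ab m unfolding u_def
    by (intro subring_add[OF R] subring_mult[OF R] subring_sum[OF R] subring_power[OF R] subring_uminus[OF R])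
  ultimately show ?thesis by blast
qed

text \<open>
  With \<open>x = t + p T\<close> for a suitable integer \<open>t\<close>, every element of \<open>S\<close> becomes constant modulo \<open>p\<close>
  and its denominator a unit, up to factors from \<open>K\<close>; so the rational functions of \<open>T\<close> with
  denominator congruent to 1 modulo \<open>p\<close> form the required ring.
\<close>

lemma padic_field_adjoin_transcendental:
  fixes x :: "'a::field_char_0"
  assumes K: "padic_field K" and trans: "\<And>q. q \<in> poly_over K \<Longrightarrow> poly q x = 0 \<Longrightarrow> q = 0"
  shows "padic_field (adjoin K x)"
  unfolding padic_field_def
proof (intro conjI allI impI)
  have Kf: "is_subfield K" using K by (simp add: padic_field_def)
  then have Kr: "is_subring K" by (rule is_subfieldD)
  show adj: "is_subfield (adjoin K x)" using Kf by (rule is_subfield_adjoin)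
  fix S assume S: "finite S \<and> S \<subseteq> adjoin K x"
  then have "\<forall>s\<in>S. \<exists>F G. F \<in> poly_over K \<and> G \<in> poly_over K \<and> poly G x \<noteq> 0 \<and> s = poly F x / poly G x"
    unfolding adjoin_def by blast
  then obtain F G where FG: "\<And>s. s \<in> S \<Longrightarrow> F s \<in> poly_over K" "\<And>s. s \<in> S \<Longrightarrow> G s \<in> poly_over K"
    "\<And>s. s \<in> S \<Longrightarrow> poly (G s) x \<noteq> 0" "\<And>s. s \<in> S \<Longrightarrow> s = poly (F s) x / poly (G s) x"
    by metis
  \<comment> \<open>An integer \<open>t\<close> at which no denominator vanishes exists, since each
    denominator has finitely many roots.\<close>
  have "finite (\<Union>s\<in>S. {z. poly (G s) z = 0})"
    using S FG(3) by (intro finite_UN_I poly_roots_finite) (auto, metis poly_0)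
  moreover have "infinite (range (of_nat :: nat \<Rightarrow> 'a))"
    by (intro range_inj_infinite inj_of_nat)
  ultimately obtain n where n: "(of_nat n :: 'a) \<notin> (\<Union>s\<in>S. {z. poly (G s) z = 0})"
    by (metis finite_subset image_subset_iff UNIV_I)
  define t where "t = (of_nat n :: 'a)"
  have Gt: "poly (G s) t \<noteq> 0" if "s \<in> S" for s using n that by (auto simp: t_def)
  have tK: "t \<in> K" using Kr by (auto simp: t_def intro: subring_of_nat)
  \<comment> \<open>With the inverses of the values \<open>poly (G s) t\<close> in \<open>A\<close>,
    each denominator can be scaled to be 1 modulo \<open>p\<close>.\<close>
  define S' where "S' = (\<Union>s\<in>S. set (coeffs (F s)) \<union> set (coeffs (G s)) \<union> {inverse (poly (G s) t)})"
  have "finite S'" using S by (simp add: S'_def)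
  moreover have "inverse (poly (G s) t) \<in> K" if "s \<in> S" for s
    using FG(2)[OF that] tK Kf poly_over_poly[OF Kr] by (auto simp: is_subfield_def)
  then have "S' \<subseteq> K"
    using poly_over_coeffs[OF FG(1)] poly_over_coeffs[OF FG(2)] unfolding S'_def by blast
  ultimately obtain p R A where pRA: "prime p" "p > 2" "R \<subseteq> K" "S' \<subseteq> A"
    "padic_ring p R" "residually_finite p R A"
    using K unfolding padic_field_def by meson
  have R: "is_subring R" and A: "is_subring A" "A \<subseteq> R"
    using pRA by (auto simp: padic_ring_def residually_finite_def)
  note PR = is_subring_poly_over[OF R]
  have FA: "F s \<in> poly_over A" "G s \<in> poly_over A" if "s \<in> S" for s
    using pRA that by (auto intro!: coeffs_poly_over A simp: S'_def)
  have tA: "t \<in> A" using A by (auto simp: t_def intro: subring_of_nat)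
  have p0: "(of_nat p :: 'a) \<noteq> 0" using pRA by simp
  define T where "T = (x - t) / of_nat p"
  have x: "x = t + of_nat p * T" using p0 by (simp add: T_def)
  \<comment> \<open>\<open>T\<close> is the value at \<open>x\<close> of the linear polynomial
    \<open>l\<close> over \<open>K\<close>, so a relation for \<open>T\<close> is one for
    \<open>x\<close>.\<close>
  have transT: "q = 0" if "q \<in> poly_over R" "poly q T = 0" for q
  proof -
    define l where "l = [:- t / of_nat p, 1 / of_nat p:]"
    have ip: "inverse (of_nat p) \<in> K" using Kf subring_of_nat[OF Kr] by (simp add: is_subfield_def)
    have "l \<in> poly_over K"
      using tK ip subring_mult[OF Kr] subring_uminus[OF Kr] poly_over_0[OF Kr]
      by (simp add: l_def poly_over_pCons[OF Kr] divide_inverse)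
    then have "pcompose q l \<in> poly_over K"
      using that poly_over_mono[OF pRA(3)] poly_over_pcompose[OF Kr] by blast
    moreover have "poly l x = T" by (simp add: l_def T_def diff_divide_distrib)
    then have "poly (pcompose q l) x = 0" using that by (simp add: poly_pcompose)
    ultimately have "pcompose q l = 0" by (rule trans)
    moreover have "degree l > 0" using p0 by (simp add: l_def)
    ultimately show ?thesis using pcompose_eq_0 by blast
  qed
  define unit where "unit H = 1 + of_nat p * poly H T" for H
  have unit: "unit H \<noteq> 0" if "H \<in> poly_over R" for H
  proof
    assume "unit H = 0"
    have "1 + smult (of_nat p) H \<in> poly_over R"
      using that by (intro subring_add[OF PR] subring_1[OF PR] poly_over_smult[OF R] subring_of_nat[OF R])
    moreover have "poly (1 + smult (of_nat p) H) T = 0" using \<open>unit H = 0\<close> by (simp add: unit_def)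
    ultimately have "1 + smult (of_nat p) H = 0" by (rule transT)
    then have "coeff (1 + smult (of_nat p) H) 0 = 0" by simp
    then have "1 + of_nat p * coeff H 0 = 0" by simp
    then show False using padic_ring_no_inverse[OF pRA(5)] that by (auto simp: poly_over_def)
  qed
  define R' where "R' = {poly E T / unit H |E H. E \<in> poly_over R \<and> H \<in> poly_over R}"
  have R'I: "poly E T / unit H \<in> R'" if "E \<in> poly_over R" "H \<in> poly_over R" for E H
    using that unfolding R'_def by blast
  have unit_mult: "\<exists>L\<in>poly_over R. unit H * unit H' = unit L" if "H \<in> poly_over R" "H' \<in> poly_over R" for H H'
  proof (intro bexI)
    show "unit H * unit H' = unit (H + H' + smult (of_nat p) (H * H'))"
      by (simp add: unit_def algebra_simps)
    show "H + H' + smult (of_nat p) (H * H') \<in> poly_over R"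
      using that by (intro subring_add[OF PR] subring_mult[OF PR] poly_over_smult[OF R] subring_of_nat[OF R])
  qed
  have unit_poly: "\<exists>L\<in>poly_over R. unit H = poly L T" if "H \<in> poly_over R" for H
  proof (intro bexI)
    show "unit H = poly (1 + smult (of_nat p) H) T" by (simp add: unit_def)
    show "1 + smult (of_nat p) H \<in> poly_over R"
      using that by (intro subring_add[OF PR] subring_1[OF PR] poly_over_smult[OF R] subring_of_nat[OF R])
  qed
  have R'_polyI: "poly E T \<in> R'" if "E \<in> poly_over R" for E
    using R'I[OF that poly_over_0[OF R]] by (simp add: unit_def)
  have emb: "R \<subseteq> R'"
  proof
    fix z assume "z \<in> R"
    then have "[:z:] \<in> poly_over R" by (simp add: poly_over_pCons[OF R] poly_over_0[OF R])
    from R'_polyI[OF this] show "z \<in> R'" by simp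
  qed
  have R'_ring: "is_subring R'"
    unfolding is_subring_def
  proof (intro conjI ballI)
    show "1 \<in> R'" using emb subring_1[OF R] by blast
  next
    fix u v assume uv: "u \<in> R'" "v \<in> R'"
    then obtain E H E' H' where *: "u = poly E T / unit H" "E \<in> poly_over R" "H \<in> poly_over R"
      "v = poly E' T / unit H'" "E' \<in> poly_over R" "H' \<in> poly_over R"
      unfolding R'_def by blast
    obtain L where L: "L \<in> poly_over R" "unit H * unit H' = unit L" using unit_mult * by blast
    obtain M M' where M: "M \<in> poly_over R" "unit H = poly M T" "M' \<in> poly_over R" "unit H' = poly M' T"
      using unit_poly * by meson
    have nz: "unit H \<noteq> 0" "unit H' \<noteq> 0" using unit * by auto
    have "u - v = (poly E T * unit H' - poly E' T * unit H) / (unit H * unit H')"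
      using nz by (simp add: * field_simps)
    then have "u - v = poly (E * M' - E' * M) T / unit L"
      by (simp add: M(2,4) flip: L(2))
    then show "u - v \<in> R'"
      using * M L by (auto simp del: poly_mult poly_diff intro!: R'I subring_diff[OF PR] subring_mult[OF PR])
    have "u * v = poly (E * E') T / unit L" by (simp add: * flip: L(2))
    then show "u * v \<in> R'"
      using R'I[OF subring_mult[OF PR *(2,5)] L(1)] by simp
  qed
  have padic: "padic_ring p R'"
    unfolding padic_ring_def
  proof (intro conjI allI impI)
    show "inverse (of_int s) \<in> R'" if "\<not> int p dvd s" for s
      using that pRA(5) emb by (auto simp: padic_ring_def)
  next
    fix z assume z: "\<forall>i. \<exists>y\<in>R'. z = of_nat p ^ i * y"
    then have "z \<in> R'" by (metis mult_1 power_0)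
    then obtain E H where EH: "z = poly E T / unit H" "E \<in> poly_over R" "H \<in> poly_over R"
      unfolding R'_def by blast
    \<comment> \<open>Clearing denominators gives an identity in R[T], which holds between
      polynomials as \<open>T\<close> is transcendental; the factor 1 + p H' is then cancelled
      modulo p^i by \<open>dvd_mod_unit\<close>.\<close>
    have "coeff E j = 0" for j
    proof (rule padic_ring_sep[OF pRA(5)])
      fix i
      obtain y where "y \<in> R'" "z = of_nat p ^ i * y" using z by blast
      then obtain E' H' where E': "z = of_nat p ^ i * (poly E' T / unit H')" "E' \<in> poly_over R" "H' \<in> poly_over R"
        unfolding R'_def by blast
      obtain M where M: "M \<in> poly_over R" "unit H = poly M T" using unit_poly EH by blast
      have "poly E T * unit H' = of_nat p ^ i * (poly E' T * unit H)"
        using unit[OF EH(3)] unit[OF E'(3)] EH(1) E'(1) by (simp add: field_simps)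
      then have 0: "poly (E * (1 + of_nat p * H') - of_nat p ^ i * (E' * M)) T = 0"
        by (simp add: unit_def M(2)[unfolded unit_def])
      have "E * (1 + of_nat p * H') - of_nat p ^ i * (E' * M) = 0"
        using EH E' M 0
        by (intro transT) (auto intro!: subring_diff[OF PR] subring_add[OF PR] subring_1[OF PR] subring_mult[OF PR] subring_power[OF PR] subring_of_nat[OF PR])
      then have "\<exists>Y\<in>poly_over R. E = of_nat p ^ i * Y"
        using EH E' M
        by (intro dvd_mod_unit[OF PR E'(3) subring_mult[OF PR E'(2) M(1)] EH(2) _ subring_of_nat[OF PR]]) simp
      then obtain Y where Y: "Y \<in> poly_over R" "E = of_nat p ^ i * Y" by blast
      then have "E = smult (of_nat (p ^ i)) Y" by (simp add: of_nat_poly poly_const_pow)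
      with Y(1) show "\<exists>y\<in>R. coeff E j = of_nat p ^ i * y" by (auto simp: poly_over_def)
    qed
    then have "E = 0" by (simp add: poly_eq_iff)
    then show "z = 0" using EH by simp
  qed (rule R'_ring)
  \<comment> \<open>Because of \<open>T\<close> all of \<open>R'\<close> has infinitely many
    residues. \<open>A'\<close> keeps the elements congruent to some element of \<open>A\<close>, so
    no new residues occur.\<close>
  define A' where "A' = {z\<in>R'. \<exists>y\<in>A. \<exists>w\<in>R'. z = y + of_nat p * w}"
  have A'I: "z \<in> A'" if "z = y + of_nat p * w" "y \<in> A" "w \<in> R'" for y z w
  proof -
    have "y \<in> R'" using that A(2) emb by auto
    then have "z \<in> R'"
      using that by (auto intro!: subring_add[OF R'_ring] subring_mult[OF R'_ring] subring_of_nat[OF R'_ring])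
    then show ?thesis using that unfolding A'_def by blast
  qed
  have A'_ring: "is_subring A'"
    unfolding is_subring_def
  proof (intro conjI ballI)
    show "1 \<in> A'"
      by (rule A'I[of _ 1 0]) (auto intro: subring_1[OF A(1)] subring_0[OF R'_ring])
  next
    fix u v assume uv: "u \<in> A'" "v \<in> A'"
    then obtain y w y' w' where *: "u = y + of_nat p * w" "y \<in> A" "w \<in> R'" "v = y' + of_nat p * w'" "y' \<in> A" "w' \<in> R'"
      unfolding A'_def by blast
    then have yR: "y \<in> R'" "y' \<in> R'" using A(2) emb by auto
    have "u - v = (y - y') + of_nat p * (w - w')" by (simp add: * algebra_simps)
    then show "u - v \<in> A'"
      by (rule A'I[OF _ subring_diff[OF A(1) *(2,5)] subring_diff[OF R'_ring *(3,6)]])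
    have eq: "u * v = y * y' + of_nat p * (w * y' + y * w' + of_nat p * (w * w'))"
      by (simp add: * algebra_simps)
    show "u * v \<in> A'"
      using * yR by (intro A'I[OF eq] subring_mult[OF A(1)] subring_add[OF R'_ring] subring_mult[OF R'_ring] subring_of_nat[OF R'_ring])
  qed
  have "residually_finite p R' A'"
  proof -
    obtain Y where Y: "finite Y" "\<And>z. z \<in> A \<Longrightarrow> \<exists>y\<in>Y. \<exists>w\<in>R. z = y + of_nat p * w"
      using pRA(6) unfolding residually_finite_def by blast
    have "\<exists>y\<in>Y. \<exists>w\<in>R'. z = y + of_nat p * w" if z: "z \<in> A'" for z
    proof -
      obtain y w where yw: "z = y + of_nat p * w" "y \<in> A" "w \<in> R'" using z unfolding A'_def by blast
      obtain y0 w0 where *: "y = y0 + of_nat p * w0" "y0 \<in> Y" "w0 \<in> R" using Y(2)[OF yw(2)] by blast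
      have "z = y0 + of_nat p * (w0 + w)" using yw * by (simp add: algebra_simps)
      moreover have "w0 + w \<in> R'" using * yw emb by (intro subring_add[OF R'_ring]) auto
      ultimately show ?thesis using *(2) by blast
    qed
    then show ?thesis using A'_ring Y(1) unfolding residually_finite_def A'_def by blast
  qed
  moreover have "S \<subseteq> A'"
  proof
    fix s assume s: "s \<in> S"
    \<comment> \<open>Multiplying numerator and denominator by \<open>g\<close> turns the
      denominator into \<open>unit H\<close>; the residue of \<open>s\<close> is then g F(t), an
      element of \<open>A\<close>.\<close>
    define g where "g = inverse (poly (G s) t)"
    have g: "g \<in> A" "g * poly (G s) t = 1" using pRA(4) s Gt[OF s] by (auto simp: g_def S'_def)
    have gR: "g \<in> R" and tR: "t \<in> R" using g tA A(2) by auto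
    have FR: "F s \<in> poly_over R" "G s \<in> poly_over R" using FA[OF s] poly_over_mono[OF A(2)] by auto
    obtain F' where F': "F' \<in> poly_over R" "poly (F s) x = poly (F s) t + of_nat p * poly F' T"
      using poly_affine_expansion[OF R FR(1) tR, of p] unfolding x by blast
    obtain G' where G': "G' \<in> poly_over R" "poly (G s) x = poly (G s) t + of_nat p * poly G' T"
      using poly_affine_expansion[OF R FR(2) tR, of p] unfolding x by blast
    define H where "H = smult g G'"
    have H: "H \<in> poly_over R" using G' gR poly_over_smult[OF R] by (simp add: H_def)
    have uH: "g * poly (G s) x = unit H" using g by (simp add: unit_def H_def G' algebra_simps)
    have "g \<noteq> 0" using g by auto
    then have "s = g * poly (F s) x / unit H" using FG(4)[OF s] by (simp flip: uH)
    also have "\<dots> = g * poly (F s) t + of_nat p * (poly (smult g F' - smult (g * poly (F s) t) H) T / unit H)"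
      using unit[OF H] by (simp add: F' field_simps) (simp add: unit_def algebra_simps)
    finally have "s = g * poly (F s) t + of_nat p * (poly (smult g F' - smult (g * poly (F s) t) H) T / unit H)" .
    moreover have "poly (smult g F' - smult (g * poly (F s) t) H) T / unit H \<in> R'"
      using gR FR F' H tR by (intro R'I subring_diff[OF PR] poly_over_smult[OF R] subring_mult[OF R] poly_over_poly[OF R])
    moreover have "g * poly (F s) t \<in> A"
      using g FA[OF s] tA by (intro subring_mult[OF A(1)] poly_over_poly[OF A(1)])
    ultimately show "s \<in> A'" by (intro A'I)
  qed
  moreover have "R' \<subseteq> adjoin K x"
  proof
    have L: "is_subring (adjoin K x)" using adj by (rule is_subfieldD)
    have sub: "K \<subseteq> adjoin K x" using Kf by (rule subset_adjoin)
    have inv: "inverse y \<in> adjoin K x" if "y \<in> adjoin K x" for y using that adj by (simp add: is_subfield_def)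
    have "T \<in> adjoin K x"
      unfolding T_def divide_inverse using in_adjoin[OF Kf] sub tK
      by (intro subring_mult[OF L] subring_diff[OF L] inv subring_of_nat[OF L]) auto
    then have pT: "poly E T \<in> adjoin K x" if "E \<in> poly_over R" for E
      using that pRA(3) sub poly_over_mono[of R "adjoin K x"] by (intro poly_over_poly[OF L]) auto
    fix z assume "z \<in> R'"
    then obtain E H where EH: "z = poly E T / unit H" "E \<in> poly_over R" "H \<in> poly_over R"
      unfolding R'_def by blast
    then show "z \<in> adjoin K x"
      unfolding EH(1) divide_inverse unit_def
      by (intro subring_mult[OF L] inv subring_add[OF L] subring_1[OF L] subring_of_nat[OF L] pT)
  qed
  ultimately show "\<exists>p R A. prime p \<and> p > 2 \<and> R \<subseteq> adjoin K x \<and> S \<subseteq> A \<and> padic_ring p R \<and> residually_finite p R A"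
    using pRA(1,2) padic by blast
qed

text \<open>Generators are adjoined one at a time, each algebraic or transcendental over the field
  reached so far.\<close>

lemma ex_padic_field:
  assumes "finite (S :: 'a::field_char_0 set)"
  shows "\<exists>K. padic_field K \<and> S \<subseteq> K"
  using assms
proof (induction S rule: finite_induct)
  case empty
  then show ?case using padic_field_rationals by blast
next
  case (insert x S)
  then obtain K where K: "padic_field K" "S \<subseteq> K" by blast
  then have Kf: "is_subfield K" by (simp add: padic_field_def)
  have "padic_field (adjoin K x)"
    using padic_field_adjoin_algebraic[OF K(1), of x] padic_field_adjoin_transcendental[OF K(1), of x] by blast
  then show ?case using K(2) subset_adjoin[OF Kf, of x] in_adjoin[OF Kf, of x] by blast
qed

section \<open>The Skolem-Mahler-Lech theorem\<close>

text \<open>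
  Since \<open>p > 2\<close>, the coefficient \<open>p\<^sup>j / j!\<close> of a falling factorial is divisible by \<open>p^(j/2)\<close>.
\<close>

lemma prime_power_in_fact:
  fixes p :: nat
  assumes p: "prime p" "p > 2"
  shows "\<exists>e s. fact j = p ^ e * s \<and> \<not> p dvd s \<and> 2 * e \<le> j"
proof -
  have rem: "\<exists>t. fact (p * q + r) = fact (p * q) * t \<and> \<not> p dvd t" if "r < p" for q r
    using that
  proof (induction r)
    case 0
    then show ?case using p by (intro exI[of _ 1]) auto
  next
    case (Suc r)
    then obtain t where t: "fact (p * q + r) = fact (p * q) * t" "\<not> p dvd t" by auto
    have "\<not> p dvd p * q + Suc r"
      using Suc.prems nat_dvd_not_less[of "Suc r" p] by (metis dvd_add_triv_right_iff dvd_add_right_iff dvd_triv_left zero_less_Suc)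
    then have "\<not> p dvd t * (p * q + Suc r)"
      using t(2) p(1) by (simp only: prime_dvd_mult_iff) simp
    moreover have "fact (p * q + Suc r) = fact (p * q) * (t * (p * q + Suc r))"
      using t(1) by (simp add: algebra_simps)
    ultimately show ?case by blast
  qed
  \<comment> \<open>The multiples of \<open>p\<close> among the factors contribute p^q q!, and the
    remaining factors are prime to \<open>p\<close>.\<close>
  have quot: "\<exists>t. fact (p * q) = p ^ q * fact q * t \<and> \<not> p dvd t" for q
  proof (induction q)
    case 0
    then show ?case using p by (intro exI[of _ 1]) auto
  next
    case (Suc q)
    then obtain t where t: "fact (p * q) = p ^ q * fact q * t" "\<not> p dvd t" by blast
    obtain t' where t': "fact (p * q + (p - 1)) = fact (p * q) * t'" "\<not> p dvd t'"
      using rem[of "p - 1" q] p by auto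
    have "p * Suc q = Suc (p * q + (p - 1))" using p by simp
    then have "fact (p * Suc q) = p * Suc q * fact (p * q + (p - 1))"
      by (metis fact_Suc of_nat_id)
    also have "\<dots> = p ^ Suc q * fact (Suc q) * (t * t')" unfolding t'(1) t(1) by (simp add: algebra_simps)
    finally have "fact (p * Suc q) = p ^ Suc q * fact (Suc q) * (t * t')" .
    moreover have "\<not> p dvd t * t'" using t t' p by (simp add: prime_dvd_mult_iff)
    ultimately show ?case by blast
  qed
  show ?thesis
  proof (induction j rule: less_induct)
    case (less j)
    obtain t where t: "fact j = fact (p * (j div p)) * t" "\<not> p dvd t"
      using rem[of "j mod p" "j div p"] p by auto
    obtain t' where t': "fact (p * (j div p)) = p ^ (j div p) * fact (j div p) * t'" "\<not> p dvd t'"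
      using quot by blast
    show ?case
    proof (cases "j < p")
      case True
      then show ?thesis using t by (intro exI[of _ 0] exI[of _ t]) simp
    next
      case False
      then have "j div p < j" using p by (intro div_less_dividend) auto
      then obtain e s where es: "fact (j div p) = p ^ e * s" "\<not> p dvd s" "2 * e \<le> j div p"
        using less by blast
      \<comment> \<open>Here \<open>p > 2\<close> enters: for q = j div p and e \<le> q/2 the new
        exponent q + e is at most 3q/2, and 3q \<le> j.\<close>
      have "3 * (j div p) \<le> p * (j div p)" using p by (intro mult_right_mono) auto
      also have "\<dots> \<le> j" by simp
      finally have le: "3 * (j div p) \<le> j" .
      have "2 * (q + e) \<le> j" if "3 * q \<le> j" "2 * e \<le> q" for q :: nat using that by presburger
      from this[OF le es(3)] have "2 * (j div p + e) \<le> j" .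
      moreover have "fact j = p ^ (j div p + e) * (s * t * t')"
        by (simp add: t t' es power_add)
      moreover have "\<not> p dvd s * t * t'" using t t' es p by (simp add: prime_dvd_mult_iff)
      ultimately show ?thesis by blast
    qed
  qed
qed

section \<open>Binomial expansions with many zeros\<close>

text \<open>All \<open>G j\<close> are divided by the same X - z; the remainders cancel in the
  weighted sum although they need not vanish one by one. Each root lowers every degree by one and
  turns constants into 0, which kills the terms with j < card Z.\<close>

lemma divide_out_roots:
  fixes e :: "nat \<Rightarrow> 'a::{idom, ring_char_0}" and G :: "nat \<Rightarrow> int poly"
  assumes "finite Z" "\<And>z. z \<in> Z \<Longrightarrow> (\<Sum>j\<in>J. e j * of_int (poly (G j) z)) = 0" "\<And>j. degree (G j) \<le> j"
  shows "\<exists>H. (\<forall>j. H j = 0 \<or> degree (H j) + card Z \<le> j) \<and>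
    (\<forall>m. (\<Sum>j\<in>J. e j * of_int (poly (G j) m)) =
      (\<Prod>z\<in>Z. of_int (m - z)) * (\<Sum>j\<in>J. e j * of_int (poly (H j) m)))"
  using assms(1,2)
proof (induction Z rule: finite_induct)
  case empty
  then show ?case using assms(3) by (intro exI[of _ G]) auto
next
  case (insert z Z)
  then obtain H where H: "\<And>j. H j = 0 \<or> degree (H j) + card Z \<le> j"
    "\<And>m. (\<Sum>j\<in>J. e j * of_int (poly (G j) m)) =
      (\<Prod>z\<in>Z. of_int (m - z)) * (\<Sum>j\<in>J. e j * of_int (poly (H j) m))"
    by auto
  \<comment> \<open>The earlier factors are nonzero at the new root \<open>z\<close>, so the
    cofactor must vanish there.\<close>
  have "(\<Prod>y\<in>Z. of_int (z - y)) \<noteq> (0::'a)" using insert.hyps by (auto simp: prod_zero_iff)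
  then have 0: "(\<Sum>j\<in>J. e j * of_int (poly (H j) z)) = 0"
    using H(2)[of z] insert.prems[of z] by simp
  define H' where "H' j = synthetic_div (H j) z" for j
  have H': "poly (H j) m = poly (H j) z + (m - z) * poly (H' j) m" for j m
    using arg_cong[OF synthetic_div_correct'[of z "H j"], of "\<lambda>q. poly q m"]
    by (simp add: H'_def algebra_simps)
  have "(\<Sum>j\<in>J. e j * of_int (poly (H j) m)) = of_int (m - z) * (\<Sum>j\<in>J. e j * of_int (poly (H' j) m))" for m
  proof -
    have "(\<Sum>j\<in>J. e j * of_int (poly (H j) m)) =
      (\<Sum>j\<in>J. e j * of_int (poly (H j) z) + of_int (m - z) * (e j * of_int (poly (H' j) m)))"
      by (subst H') (simp add: algebra_simps)
    then show ?thesis by (simp add: sum.distrib 0 flip: sum_distrib_left)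
  qed
  then have "(\<Sum>j\<in>J. e j * of_int (poly (G j) m)) =
      (\<Prod>z\<in>insert z Z. of_int (m - z)) * (\<Sum>j\<in>J. e j * of_int (poly (H' j) m))" for m
    using insert.hyps by (simp add: H(2))
  moreover have "H' j = 0 \<or> degree (H' j) + card (insert z Z) \<le> j" for j
  proof (cases "degree (H j) = 0")
    case True
    then show ?thesis by (simp add: H'_def synthetic_div_eq_0_iff)
  next
    case False
    then have "H j \<noteq> 0" by auto
    then have "degree (H j) + card Z \<le> j" using H(1)[of j] by simp
    then show ?thesis using False insert.hyps by (simp add: H'_def degree_synthetic_div)
  qed
  ultimately show ?case by blast
qed

text \<open>Newton's forward-difference expansion with j-th difference at 0 in p^j R. Terms beyond
  \<open>m\<close> would have zero binomial coefficient, so each value is a finite sum.\<close>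

definition mahler_seq :: "nat \<Rightarrow> 'a::field_char_0 set \<Rightarrow> (nat \<Rightarrow> 'a) \<Rightarrow> bool"
  where "mahler_seq p R x \<longleftrightarrow>
    (\<exists>d. (\<forall>j. d j \<in> R) \<and> (\<forall>m. x m = (\<Sum>j\<le>m. of_nat (m choose j) * of_nat p ^ j * d j)))"

text \<open>
  Dividing out \<open>2i\<close> zeros removes the terms with \<open>j < 2i\<close>, and the remaining ones are divisible by
  \<open>p^i\<close>.
\<close>

lemma mahler_seq_infinite_zeros:
  fixes x :: "nat \<Rightarrow> 'a::field_char_0"
  assumes p: "prime p" "p > 2" "padic_ring p R"
    and x: "mahler_seq p R x" "infinite {m. x m = 0}"
  shows "x m = 0"
proof (rule padic_ring_sep[OF p(3)])
  fix i
  have R: "is_subring R" using p(3) by (simp add: padic_ring_def)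
  obtain d where d: "\<And>j. d j \<in> R" "\<And>m. x m = (\<Sum>j\<le>m. of_nat (m choose j) * of_nat p ^ j * d j)"
    using x(1) unfolding mahler_seq_def by blast
  obtain Z where Z: "finite Z" "card Z = 2 * i" "Z \<subseteq> {m. x m = 0}"
    using infinite_arbitrarily_large[OF x(2)] by blast
  \<comment> \<open>One truncation bound for \<open>m\<close> and all of \<open>Z\<close>, so that a
    single polynomial expression gives \<open>x\<close> at all these points.\<close>
  define N where "N = Max (insert m Z)"
  have N: "m \<le> N" "\<And>z. z \<in> Z \<Longrightarrow> z \<le> N" using Z(1) by (auto simp: N_def)
  define e where "e j = of_nat p ^ j * d j / fact j" for j
  \<comment> \<open>The falling factorial, j! times the binomial coefficient, has integer
    coefficients; the factorial moves into the denominator of \<open>e j\<close>.\<close>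
  define G where "G j = (\<Prod>l=0..<j. [:- int l, 1:])" for j
  have G: "of_int (poly (G j) (int n)) = (fact j * of_nat (n choose j) :: 'a)" for j n
    by (simp add: G_def poly_prod binomial_gbinomial gbinomial_prod_rev)
  have xG: "x n = (\<Sum>j\<le>N. e j * of_int (poly (G j) (int n)))" if "n \<le> N" for n
  proof -
    have "x n = (\<Sum>j\<le>N. of_nat (n choose j) * of_nat p ^ j * d j)"
      unfolding d(2) using that by (intro sum.mono_neutral_left) auto
    then show ?thesis by (simp add: G e_def mult_ac)
  qed
  have "degree (G j) \<le> j" for j
    unfolding G_def using degree_prod_sum_le[of "{0..<j}" "\<lambda>l. [:- int l, 1:]"] by simp
  moreover have "(\<Sum>j\<le>N. e j * of_int (poly (G j) z)) = 0" if "z \<in> int ` Z" for z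
    using that Z(3) xG[OF N(2)] by auto
  ultimately obtain H where H: "\<And>j. H j = 0 \<or> degree (H j) + card (int ` Z) \<le> j"
    "\<And>m. (\<Sum>j\<le>N. e j * of_int (poly (G j) m)) =
      (\<Prod>z\<in>int ` Z. of_int (m - z)) * (\<Sum>j\<le>N. e j * of_int (poly (H j) m))"
    using divide_out_roots[of "int ` Z" e G "{..N}"] Z(1) by blast
  have "\<exists>w\<in>R. e j * of_int (poly (H j) (int m)) = of_nat p ^ i * w" for j
  proof (cases "H j = 0")
    case True
    then show ?thesis using subring_0[OF R] by (intro bexI[of _ 0]) auto
  next
    case False
    then have "2 * i \<le> j" using H(1)[of j] Z(2) by (simp add: card_image)
    obtain E s where Es: "fact j = p ^ E * s" "\<not> p dvd s" "2 * E \<le> j"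
      using prime_power_in_fact[OF p(1,2)] by blast
    have s: "inverse (of_nat s) \<in> R"
      using p(3) Es(2) unfolding padic_ring_def by (metis int_dvd_int_iff of_int_of_nat_eq)
    \<comment> \<open>Both E and i are at most j/2, so after cancelling p^E a factor p^i can still
      be split off from p^j.\<close>
    define D where "D = j - E - i"
    have D: "j = E + i + D" using Es(3) \<open>2 * i \<le> j\<close> by (simp add: D_def)
    have s0: "(of_nat s :: 'a) \<noteq> 0" "(of_nat p :: 'a) \<noteq> 0" using Es(2) p by (auto intro: Nat.gr0I)
    have "(fact j :: 'a) = of_nat p ^ E * of_nat s"
      using arg_cong[OF Es(1), of "of_nat :: nat \<Rightarrow> 'a"] by simp
    then have "e j = of_nat p ^ i * (of_nat p ^ D * d j * inverse (of_nat s))"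
      using s0 by (simp add: e_def D power_add field_simps)
    then have "e j * of_int (poly (H j) (int m)) =
      of_nat p ^ i * (of_nat p ^ D * d j * inverse (of_nat s) * of_int (poly (H j) (int m)))"
      by simp
    moreover have "of_nat p ^ D * d j * inverse (of_nat s) * of_int (poly (H j) (int m)) \<in> R"
      using d(1) s by (intro subring_mult[OF R] subring_power[OF R] subring_of_nat[OF R] subring_of_int[OF R])
    ultimately show ?thesis by blast
  qed
  then obtain w where w: "\<And>j. w j \<in> R" "\<And>j. e j * of_int (poly (H j) (int m)) = of_nat p ^ i * w j"
    by metis
  have "x m = of_nat p ^ i * ((\<Prod>z\<in>int ` Z. of_int (int m - z)) * (\<Sum>j\<le>N. w j))"
    unfolding xG[OF N(1)] H(2) w(2) by (simp flip: sum_distrib_left)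
  moreover have "of_int (\<Prod>z\<in>int ` Z. int m - z) * (\<Sum>j\<le>N. w j) \<in> R"
    using w(1) by (intro subring_mult[OF R] subring_of_int[OF R] subring_sum[OF R])
  ultimately show "\<exists>y\<in>R. x m = of_nat p ^ i * y" by auto
qed

lemma mahler_seq_add:
  assumes R: "is_subring R" and "mahler_seq p R x" "mahler_seq p R y"
  shows "mahler_seq p R (\<lambda>m. x m + y m)"
proof -
  obtain d d' where "\<And>j. d j \<in> R" "\<And>m. x m = (\<Sum>j\<le>m. of_nat (m choose j) * of_nat p ^ j * d j)"
    "\<And>j. d' j \<in> R" "\<And>m. y m = (\<Sum>j\<le>m. of_nat (m choose j) * of_nat p ^ j * d' j)"
    using assms(2,3) unfolding mahler_seq_def by blast
  then show ?thesis
    unfolding mahler_seq_def by (intro exI[of _ "\<lambda>j. d j + d' j"])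
      (auto simp: algebra_simps sum.distrib intro: subring_add[OF R])
qed

lemma mahler_seq_0: "is_subring R \<Longrightarrow> mahler_seq p R (\<lambda>m. 0)"
  unfolding mahler_seq_def by (intro exI[of _ "\<lambda>j. 0"]) (auto intro: subring_0)

lemma mahler_seq_sum:
  assumes R: "is_subring R" and "\<And>i. i \<in> I \<Longrightarrow> mahler_seq p R (f i)"
  shows "mahler_seq p R (\<lambda>m. \<Sum>i\<in>I. f i m)"
  using assms(2)
  by (induction I rule: infinite_finite_induct) (auto intro: mahler_seq_0[OF R] mahler_seq_add[OF R])

lemma mahler_seq_power:
  assumes R: "is_subring R" and "c \<in> R" "w \<in> R"
  shows "mahler_seq p R (\<lambda>m. c * (1 + of_nat p * w) ^ m)"
  unfolding mahler_seq_def
proof (intro exI conjI allI)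
  show "c * w ^ j \<in> R" for j
    using assms by (intro subring_mult subring_power)
  show "c * (1 + of_nat p * w) ^ m = (\<Sum>j\<le>m. of_nat (m choose j) * of_nat p ^ j * (c * w ^ j))" for m
    using binomial_ring[of "of_nat p * w" 1 m]
    by (simp add: sum_distrib_left power_mult_distrib add.commute mult_ac)
qed

text \<open>By m C(m,j) = j C(m,j) + (j+1) C(m,j+1), part of each term moves from j to j+1; the
  factor \<open>p\<close> next to \<open>m\<close> supplies the extra power that the moved term
  needs.\<close>

lemma mahler_seq_mult_index:
  fixes x :: "nat \<Rightarrow> 'a::field_char_0"
  assumes R: "is_subring R" and "mahler_seq p R x"
  shows "mahler_seq p R (\<lambda>m. of_nat (p * m) * x m)"
proof -
  obtain d where d: "\<And>j. d j \<in> R" "\<And>m. x m = (\<Sum>j\<le>m. of_nat (m choose j) * of_nat p ^ j * d j)"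
    using assms(2) unfolding mahler_seq_def by blast
  have choose: "m * (m choose j) = j * (m choose j) + Suc j * (m choose Suc j)" if "j \<le> m" for m j
  proof -
    have "Suc j * (m choose Suc j) = (m - j) * (m choose j)"
      by (cases m) (simp_all only: Suc_times_binomial binomial_absorb_comp, simp_all)
    then have "j * (m choose j) + Suc j * (m choose Suc j) = (j + (m - j)) * (m choose j)"
      by (simp only: add_mult_distrib)
    then show ?thesis using that by simp
  qed
  show ?thesis
    unfolding mahler_seq_def
  proof (intro exI conjI allI)
    \<comment> \<open>At j = 0 the truncated index \<open>j - 1\<close> is harmless because of the
      factor \<open>of_nat j\<close>.\<close>
    show "of_nat j * of_nat p * d j + of_nat j * d (j - 1) \<in> R" for j
      using d(1) R by (intro subring_add subring_mult subring_of_nat)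
    fix m
    define g where "g j = of_nat (m choose j) * of_nat p ^ j * (of_nat j * d (j - 1))" for j
    \<comment> \<open>Both boundary terms vanish: \<open>g 0\<close> by its factor j,
      \<open>g (Suc m)\<close> by its binomial coefficient.\<close>
    have "(\<Sum>j\<le>m. g (Suc j)) = (\<Sum>j\<le>Suc m. g j)"
      by (simp only: sum.atMost_Suc_shift) (simp add: g_def)
    also have "\<dots> = (\<Sum>j\<le>m. g j)" by (simp add: g_def)
    finally have g: "(\<Sum>j\<le>m. g (Suc j)) = (\<Sum>j\<le>m. g j)" .
    have "of_nat (p * m) * x m = (\<Sum>j\<le>m. of_nat (m * (m choose j)) * of_nat p ^ Suc j * d j)"
      by (simp add: d(2) sum_distrib_left mult_ac)
    also have "\<dots> = (\<Sum>j\<le>m. of_nat (m choose j) * of_nat p ^ j * (of_nat j * of_nat p * d j) + g (Suc j))"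
    proof (rule sum.cong[OF refl])
      fix j assume "j \<in> {..m}"
      then have "(of_nat (m * (m choose j)) :: 'a) = of_nat (j * (m choose j)) + of_nat (Suc j * (m choose Suc j))"
        using choose[of j m] by (metis atMost_iff of_nat_add)
      then show "of_nat (m * (m choose j)) * of_nat p ^ Suc j * d j =
        of_nat (m choose j) * of_nat p ^ j * (of_nat j * of_nat p * d j) + g (Suc j)"
        by (simp only: g_def of_nat_mult) (simp add: algebra_simps)
    qed
    also have "\<dots> = (\<Sum>j\<le>m. of_nat (m choose j) * of_nat p ^ j * (of_nat j * of_nat p * d j + of_nat j * d (j - 1)))"
      by (simp add: sum.distrib g) (simp add: g_def algebra_simps sum.distrib)
    finally show "of_nat (p * m) * x m =
      (\<Sum>j\<le>m. of_nat (m choose j) * of_nat p ^ j * (of_nat j * of_nat p * d j + of_nat j * d (j - 1)))" .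
  qed
qed

lemma mahler_seq_poly_power:
  assumes R: "is_subring R" and "c \<in> R" "w \<in> R" "Q \<in> poly_over R"
  shows "mahler_seq p R (\<lambda>m. poly Q (of_nat (p * m)) * (c * (1 + of_nat p * w) ^ m))"
  using assms(4)
proof (induction Q)
  case 0
  then show ?case using mahler_seq_0[OF R] by simp
next
  case (pCons a Q)
  then have *: "a \<in> R" "Q \<in> poly_over R" by (simp_all add: poly_over_pCons[OF R])
  have "mahler_seq p R (\<lambda>m. (a * c) * (1 + of_nat p * w) ^ m +
    of_nat (p * m) * (poly Q (of_nat (p * m)) * (c * (1 + of_nat p * w) ^ m)))"
    using * assms pCons.IH
    by (intro mahler_seq_add mahler_seq_power mahler_seq_mult_index subring_mult) auto
  then show ?case by (simp add: algebra_simps)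
qed

section \<open>Zeros along progressions\<close>

text \<open>Pigeonhole: two powers of \<open>b\<close> share a residue representative, and their
  common factor \<open>b ^ s\<close> cancels because \<open>inverse b\<close> lies in
  \<open>R\<close>.\<close>

lemma power_eq_1_mod_p:
  fixes b :: "'a::field_char_0"
  assumes RA: "is_subring R" "residually_finite p R A" and b: "b \<in> A" "inverse b \<in> A" "b \<noteq> 0"
  shows "\<exists>k>0. \<exists>w\<in>R. b ^ k = 1 + of_nat p * w"
proof -
  obtain Y where A: "is_subring A" "A \<subseteq> R" and Y: "finite Y" "\<And>z. z \<in> A \<Longrightarrow> \<exists>y\<in>Y. \<exists>w\<in>R. z = y + of_nat p * w"
    using RA(2) unfolding residually_finite_def by blast
  have "\<forall>n. \<exists>y w. y \<in> Y \<and> w \<in> R \<and> b ^ n = y + of_nat p * w"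
    using Y(2) subring_power[OF A(1) b(1)] by blast
  then obtain y w where yw: "\<And>n. y n \<in> Y" "\<And>n. w n \<in> R" "\<And>n. b ^ n = y n + of_nat p * w n"
    by metis
  have "range y \<subseteq> Y" using yw(1) by auto
  then have "\<not> inj y" using Y(1) by (metis finite_imageD finite_subset infinite_UNIV_nat)
  then obtain s t where st: "s < t" "y s = y t" by (metis injI linorder_neqE_nat)
  have "b ^ t = b ^ s * b ^ (t - s)" using st by (simp flip: power_add)
  then have "b ^ s * (b ^ (t - s) - 1) = of_nat p * (w t - w s)"
    using yw(3)[of s] yw(3)[of t] st(2) by (simp add: algebra_simps)
  then have "b ^ (t - s) - 1 = of_nat p * ((w t - w s) * inverse b ^ s)"
    using b(3) by (simp add: field_simps)
  then have "b ^ (t - s) = 1 + of_nat p * ((w t - w s) * inverse b ^ s)" by (simp add: algebra_simps)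
  moreover have "inverse b \<in> R" using A b by auto
  then have "(w t - w s) * inverse b ^ s \<in> R"
    using yw(2) by (intro subring_mult[OF RA(1)] subring_diff[OF RA(1)] subring_power[OF RA(1)])
  moreover have "t - s > 0" using st by simp
  ultimately show ?thesis by blast
qed

lemma power_1_mod_p:
  assumes R: "is_subring R" and w: "w \<in> R"
  shows "\<exists>w'\<in>R. (1 + of_nat p * w) ^ n = 1 + of_nat p * (w' :: 'a::comm_ring_1)"
proof (induction n)
  case 0
  then show ?case using subring_0[OF R] by (intro bexI[of _ 0]) auto
next
  case (Suc n)
  then obtain w' where w': "w' \<in> R" "(1 + of_nat p * w) ^ n = 1 + of_nat p * w'" by blast
  have "(1 + of_nat p * w) ^ Suc n = 1 + of_nat p * (w + w' + of_nat p * (w * w'))"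
    by (simp only: power_Suc w'(2)) (simp add: algebra_simps)
  then show ?case using w w'(1) by (metis subring_add[OF R] subring_mult[OF R] subring_of_nat[OF R])
qed

text \<open>For a suitable \<open>M\<close> every \<open>\<beta> i ^ M\<close> is 1 modulo
  \<open>p\<close>, so along each class modulo \<open>M\<close> the values form a
  \<open>mahler_seq\<close>. Some class contains infinitely many zeros, and
  \<open>mahler_seq_infinite_zeros\<close> applies to it.\<close>

theorem skolem_mahler_lech:
  fixes P :: "'i \<Rightarrow> 'a::field_char_0 poly" and \<beta> :: "'i \<Rightarrow> 'a"
  assumes I: "finite I" and \<beta>: "\<And>i. i \<in> I \<Longrightarrow> \<beta> i \<noteq> 0"
    and inf: "infinite {n. (\<Sum>i\<in>I. poly (P i) (of_nat n) * \<beta> i ^ n) = 0}"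
  shows "\<exists>r k. k > 0 \<and> (\<forall>m. (\<Sum>i\<in>I. poly (P i) (of_nat (r + k * m)) * \<beta> i ^ (r + k * m)) = 0)"
proof -
  define S where "S = \<beta> ` I \<union> inverse ` \<beta> ` I \<union> (\<Union>i\<in>I. set (coeffs (P i)))"
  have "finite S" using I by (simp add: S_def)
  then obtain K where "padic_field K" "S \<subseteq> K" using ex_padic_field by blast
  then obtain p R A where p: "prime p" "p > 2" and SA: "S \<subseteq> A" and pR: "padic_ring p R"
    and RA: "residually_finite p R A"
    using \<open>finite S\<close> unfolding padic_field_def by meson
  have R: "is_subring R" and A: "is_subring A" "A \<subseteq> R"
    using pR RA by (auto simp: padic_ring_def residually_finite_def)
  have SR: "S \<subseteq> R" using SA A by auto
  have "\<forall>i\<in>I. \<exists>k>0. \<exists>w\<in>R. \<beta> i ^ k = 1 + of_nat p * w"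
  proof
    fix i assume "i \<in> I"
    then have "\<beta> i \<in> A" "inverse (\<beta> i) \<in> A" using SA by (auto simp: S_def)
    then show "\<exists>k>0. \<exists>w\<in>R. \<beta> i ^ k = 1 + of_nat p * w"
      using power_eq_1_mod_p[OF R RA] \<beta>[OF \<open>i \<in> I\<close>] by blast
  qed
  then obtain k where k: "\<And>i. i \<in> I \<Longrightarrow> k i > 0 \<and> (\<exists>w\<in>R. \<beta> i ^ k i = 1 + of_nat p * w)" by metis
  \<comment> \<open>\<open>L\<close> is a multiple of every exponent \<open>k i\<close>. The extra
    factor \<open>p\<close> in \<open>M\<close> allows r + M m to be written as r + L (p m), with
    the argument p m that \<open>mahler_seq_poly_power\<close> requires.\<close>
  define L where "L = (\<Prod>i\<in>I. k i)"
  define M where "M = L * p"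
  have L: "L > 0" using k by (auto simp: L_def intro!: prod_pos)
  then have M: "M > 0" using p by (simp add: M_def)
  have "\<exists>w\<in>R. \<beta> i ^ M = 1 + of_nat p * w" if i: "i \<in> I" for i
  proof -
    obtain w where w: "w \<in> R" "\<beta> i ^ k i = 1 + of_nat p * w" using k[OF i] by blast
    have "k i dvd M" unfolding M_def L_def using i I by (intro dvd_mult2 dvd_prodI)
    then obtain c where "M = k i * c" by (rule dvdE)
    then have "\<beta> i ^ M = (1 + of_nat p * w) ^ c" by (simp add: power_mult w(2))
    then show ?thesis using power_1_mod_p[OF R w(1)] by metis
  qed
  then obtain w where w: "\<And>i. i \<in> I \<Longrightarrow> w i \<in> R \<and> \<beta> i ^ M = 1 + of_nat p * w i" by metis
  define x where "x n = (\<Sum>i\<in>I. poly (P i) (of_nat n) * \<beta> i ^ n)" for n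
  \<comment> \<open>Pigeonhole over the residue classes modulo \<open>M\<close>.\<close>
  have "\<exists>r. infinite {m. x (r + M * m) = 0}"
  proof (rule ccontr)
    assume "\<nexists>r. infinite {m. x (r + M * m) = 0}"
    then have "finite (\<Union>r<M. (\<lambda>m. r + M * m) ` {m. x (r + M * m) = 0})" by simp
    moreover have "{n. x n = 0} \<subseteq> (\<Union>r<M. (\<lambda>m. r + M * m) ` {m. x (r + M * m) = 0})"
    proof
      fix n assume "n \<in> {n. x n = 0}"
      then have "n \<in> (\<lambda>m. n mod M + M * m) ` {m. x (n mod M + M * m) = 0}"
        by (intro image_eqI[of _ _ "n div M"]) auto
      then show "n \<in> (\<Union>r<M. (\<lambda>m. r + M * m) ` {m. x (r + M * m) = 0})" using M by auto
    qed
    ultimately show False using inf finite_subset unfolding x_def by blast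
  qed
  then obtain r where r: "infinite {m. x (r + M * m) = 0}" by blast
  define Q where "Q i = pcompose (P i) [:of_nat r, of_nat L:]" for i
  have "mahler_seq p R (\<lambda>m. x (r + M * m))"
  proof -
    have "mahler_seq p R (\<lambda>m. \<Sum>i\<in>I. poly (Q i) (of_nat (p * m)) * (\<beta> i ^ r * (1 + of_nat p * w i) ^ m))"
    proof (intro mahler_seq_sum[OF R] mahler_seq_poly_power[OF R])
      fix i assume i: "i \<in> I"
      show "\<beta> i ^ r \<in> R" using SR i by (intro subring_power[OF R]) (auto simp: S_def)
      show "w i \<in> R" using w[OF i] by simp
      show "Q i \<in> poly_over R"
        unfolding Q_def using SR i
        by (intro poly_over_pcompose[OF R] coeffs_poly_over[OF R, of "P i"])
          (auto simp: S_def poly_over_pCons[OF R] poly_over_0[OF R] subring_of_nat[OF R])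
    qed
    also have "(\<lambda>m. \<Sum>i\<in>I. poly (Q i) (of_nat (p * m)) * (\<beta> i ^ r * (1 + of_nat p * w i) ^ m)) = (\<lambda>m. x (r + M * m))"
      unfolding x_def Q_def
      by (intro ext sum.cong refl)
        (simp add: w[THEN conjunct2, symmetric] poly_pcompose power_add M_def mult_ac flip: power_mult)
    finally show ?thesis .
  qed
  then have "x (r + M * m) = 0" for m using r by (rule mahler_seq_infinite_zeros[OF p pR])
  then show ?thesis using M unfolding x_def by blast
qed

section \<open>Nondegenerate exponential polynomials\<close>

text \<open>Shifting \<open>m\<close> by one and subtracting \<open>\<gamma> i\<^sub>0\<close> times
  the sequence lowers the degree of \<open>P i\<^sub>0\<close> and keeps the degrees of the other
  coefficients, as the bases are distinct. Repetition removes the base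
  \<open>\<gamma> i\<^sub>0\<close>.\<close>

lemma exp_poly_eq_0:
  fixes P :: "'i \<Rightarrow> 'a::field_char_0 poly" and \<gamma> :: "'i \<Rightarrow> 'a"
  assumes "finite I" "inj_on \<gamma> I" "\<And>i. i \<in> I \<Longrightarrow> \<gamma> i \<noteq> 0"
    and "\<And>m. (\<Sum>i\<in>I. poly (P i) (of_nat m) * \<gamma> i ^ m) = 0"
  shows "\<forall>i\<in>I. P i = 0"
  using assms
proof (induction I arbitrary: P rule: finite_induct)
  case (insert i\<^sub>0 I)
  \<comment> \<open>The zero polynomial counts as below every bound, so the induction on
    \<open>n\<close> starts with \<open>P i\<^sub>0 = 0\<close>.\<close>
  have "\<forall>i\<in>insert i\<^sub>0 I. P i = 0"
    if "P i\<^sub>0 = 0 \<or> degree (P i\<^sub>0) < n" "\<And>m. (\<Sum>i\<in>insert i\<^sub>0 I. poly (P i) (of_nat m) * \<gamma> i ^ m) = 0" for n P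
    using that
  proof (induction n arbitrary: P)
    case 0
    then have "P i\<^sub>0 = 0" by simp
    moreover have "\<forall>i\<in>I. P i = 0"
    proof (rule insert.IH)
      show "inj_on \<gamma> I" using insert.prems(1) by simp
      show "\<gamma> i \<noteq> 0" if "i \<in> I" for i using insert.prems(2) that by simp
      show "(\<Sum>i\<in>I. poly (P i) (of_nat m) * \<gamma> i ^ m) = 0" for m
        using 0(2)[of m] \<open>P i\<^sub>0 = 0\<close> insert.hyps by simp
    qed
    ultimately show ?case by simp
  next
    case (Suc n)
    define P' where "P' i = smult (\<gamma> i) (pcompose (P i) [:1, 1:]) - smult (\<gamma> i\<^sub>0) (P i)" for i
    have "(\<Sum>i\<in>insert i\<^sub>0 I. poly (P' i) (of_nat m) * \<gamma> i ^ m) = 0" for m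
    proof -
      have "(\<Sum>i\<in>insert i\<^sub>0 I. poly (P' i) (of_nat m) * \<gamma> i ^ m) =
        (\<Sum>i\<in>insert i\<^sub>0 I. poly (P i) (of_nat (Suc m)) * \<gamma> i ^ Suc m
          - \<gamma> i\<^sub>0 * (poly (P i) (of_nat m) * \<gamma> i ^ m))"
        by (intro sum.cong refl) (simp add: P'_def poly_pcompose algebra_simps)
      then show ?thesis by (simp only: sum_subtractf Suc.prems(2) flip: sum_distrib_left) simp
    qed
    moreover have "P' i\<^sub>0 = 0 \<or> degree (P' i\<^sub>0) < n"
    proof (cases "P i\<^sub>0 = 0")
      case False
      have le: "degree (P' i\<^sub>0) \<le> degree (P i\<^sub>0)"
        unfolding P'_def by (intro degree_diff_le order.trans[OF degree_smult_le]) (simp_all add: degree_pcompose)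
      have "lead_coeff (pcompose (P i\<^sub>0) [:1, 1:]) = lead_coeff (P i\<^sub>0)"
        by (subst lead_coeff_comp) auto
      then have "coeff (P' i\<^sub>0) (degree (P i\<^sub>0)) = 0"
        by (simp add: P'_def degree_pcompose)
      then show ?thesis
        using eq_zero_or_degree_less[OF le] Suc.prems(1) False by auto
    qed (simp add: P'_def)
    ultimately have P': "\<forall>i\<in>insert i\<^sub>0 I. P' i = 0" using Suc.IH by blast
    have PI: "P i = 0" if i: "i \<in> I" for i
    proof (rule ccontr)
      assume "P i \<noteq> 0"
      have "\<gamma> i \<noteq> \<gamma> i\<^sub>0" using insert.prems(1) insert.hyps(2) i by (auto simp: inj_on_def)
      have "smult (\<gamma> i) (pcompose (P i) [:1, 1:]) = smult (\<gamma> i\<^sub>0) (P i)"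
        using P' i by (simp add: P'_def)
      then have "lead_coeff (smult (\<gamma> i) (pcompose (P i) [:1, 1:])) = lead_coeff (smult (\<gamma> i\<^sub>0) (P i))"
        by simp
      then have "\<gamma> i * lead_coeff (P i) = \<gamma> i\<^sub>0 * lead_coeff (P i)"
        unfolding lead_coeff_smult by (subst (asm) lead_coeff_comp) auto
      then show False using \<open>P i \<noteq> 0\<close> \<open>\<gamma> i \<noteq> \<gamma> i\<^sub>0\<close> by simp
    qed
    have "poly (P i\<^sub>0) (of_nat m) = 0" for m
      using Suc.prems(2)[of m] PI insert.hyps insert.prems(2)[of i\<^sub>0] by simp
    then have "range of_nat \<subseteq> {z. poly (P i\<^sub>0) z = 0}" by auto
    moreover have "infinite (range (of_nat :: nat \<Rightarrow> 'a))"
      by (intro range_inj_infinite inj_of_nat)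
    ultimately have "P i\<^sub>0 = 0" using poly_roots_finite finite_subset by blast
    then show ?case using PI by simp
  qed
  from this[of P "Suc (degree (P i\<^sub>0))"] insert.prems(3) show ?case by simp
qed simp

text \<open>Along the progression the bases become \<open>\<beta> i ^ k\<close>. They stay distinct
  because no quotient of two bases with different indices is a root of unity, so
  \<open>exp_poly_eq_0\<close> applies.\<close>

corollary skolem_mahler_lech_nondegenerate:
  fixes P :: "'i \<Rightarrow> 'a::field_char_0 poly" and \<beta> :: "'i \<Rightarrow> 'a"
  assumes I: "finite I" and \<beta>: "\<And>i. i \<in> I \<Longrightarrow> \<beta> i \<noteq> 0"
    and inf: "infinite {n. (\<Sum>i\<in>I. poly (P i) (of_nat n) * \<beta> i ^ n) = 0}"
    and nondeg: "\<And>i j k. i \<in> I \<Longrightarrow> j \<in> I \<Longrightarrow> k > 0 \<Longrightarrow> \<beta> i ^ k = \<beta> j ^ k \<Longrightarrow> i = j"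
    and i: "i \<in> I"
  shows "P i = 0"
proof -
  obtain r k where k: "k > 0"
    and zero: "\<And>m. (\<Sum>i\<in>I. poly (P i) (of_nat (r + k * m)) * \<beta> i ^ (r + k * m)) = 0"
    using skolem_mahler_lech[OF I \<beta> inf] by blast
  define Q where "Q i = smult (\<beta> i ^ r) (pcompose (P i) [:of_nat r, of_nat k:])" for i
  have "\<forall>i\<in>I. Q i = 0"
  proof (rule exp_poly_eq_0[OF I])
    show "inj_on (\<lambda>i. \<beta> i ^ k) I" using nondeg k by (auto intro: inj_onI)
    show "\<beta> i ^ k \<noteq> 0" if "i \<in> I" for i using \<beta>[OF that] by simp
    have "(\<Sum>i\<in>I. poly (Q i) (of_nat m) * (\<beta> i ^ k) ^ m)
      = (\<Sum>i\<in>I. poly (P i) (of_nat (r + k * m)) * \<beta> i ^ (r + k * m))" for m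
      by (intro sum.cong refl) (simp add: Q_def poly_pcompose power_add power_mult mult_ac)
    then show "(\<Sum>i\<in>I. poly (Q i) (of_nat m) * (\<beta> i ^ k) ^ m) = 0" for m
      using zero by simp
  qed
  then have "pcompose (P i) [:of_nat r, of_nat k:] = 0" using \<beta>[OF i] i by (auto simp: Q_def)
  then show ?thesis using pcompose_eq_0[of "P i" "[:of_nat r, of_nat k:]"] k by simp
qed

section \<open>Common values of two exponential families\<close>

definition poly2 :: "'a::comm_ring_1 poly poly \<Rightarrow> 'a \<Rightarrow> 'a \<Rightarrow> 'a"
  where "poly2 F u v = poly (poly F [:u:]) v"

lemma poly2_simps [simp]:
  "poly2 (F + G) u v = poly2 F u v + poly2 G u v"
  "poly2 (F - G) u v = poly2 F u v - poly2 G u v"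
  "poly2 (F * G) u v = poly2 F u v * poly2 G u v"
  "poly2 (F ^ n) u v = poly2 F u v ^ n"
  "poly2 (\<Sum>i\<in>I. H i) u v = (\<Sum>i\<in>I. poly2 (H i) u v)"
  "poly2 1 u v = 1" "poly2 [:0, 1:] u v = u" "poly2 [:q:] u v = poly q v"
  "poly2 (smult q F) u v = poly q v * poly2 F u v"
  by (simp_all add: poly2_def poly_sum)

lemma poly2_sum1: "poly2 F u v = (\<Sum>i\<le>degree F. poly (coeff F i) v * u ^ i)"
  by (simp add: poly2_def poly_altdef[of F] poly_sum)

lemma poly2_sum2:
  "poly2 F u v = (\<Sum>(i, j)\<in>(SIGMA i:{..degree F}. {..degree (coeff F i)}). coeff (coeff F i) j * (u ^ i * v ^ j))"
  by (simp add: poly2_sum1 poly_altdef[of "coeff F _"] sum_distrib_left sum_distrib_right mult_ac flip: sum.Sigma)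

text \<open>\<open>c\<close> at the fraction W / D, cleared of denominators by the factor D^(degree
  c).\<close>

definition homogenize :: "'a::field poly \<Rightarrow> 'a poly poly \<Rightarrow> 'a poly poly \<Rightarrow> 'a poly poly"
  where "homogenize c W D = (\<Sum>i\<le>degree c. [:[:coeff c i:]:] * W ^ i * D ^ (degree c - i))"

lemma poly2_homogenize:
  assumes "poly2 D u v \<noteq> 0"
  shows "poly2 (homogenize c W D) u v = poly2 D u v ^ degree c * poly c (poly2 W u v / poly2 D u v)"
proof -
  have "coeff c i * poly2 W u v ^ i * poly2 D u v ^ (degree c - i) =
    poly2 D u v ^ degree c * (coeff c i * (poly2 W u v / poly2 D u v) ^ i)" if "i \<le> degree c" for i
  proof -
    have "poly2 D u v ^ degree c = poly2 D u v ^ (degree c - i) * poly2 D u v ^ i"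
      using that by (simp flip: power_add)
    then show ?thesis using assms by (simp add: power_divide)
  qed
  then show ?thesis
    unfolding homogenize_def poly2_simps poly_altdef sum_distrib_left
    by (intro sum.cong refl) simp
qed

text \<open>In \<open>n\<close> this is an exponential sum with constant coefficients and bases
  \<open>a ^ i * b ^ j\<close>, nondegenerate by independence.\<close>

lemma poly2_eq_0_if_independent:
  fixes a b :: "'a::field_char_0"
  assumes nz: "a \<noteq> 0" "b \<noteq> 0"
    and indep: "\<And>i j i' j'. a ^ i * b ^ j = a ^ i' * b ^ j' \<Longrightarrow> i = i' \<and> j = j'"
    and inf: "infinite {n. poly2 F (a ^ n) (b ^ n) = 0}"
  shows "poly2 F u v = 0"
proof -
  define I where "I = (SIGMA i:{..degree F}. {..degree (coeff F i)})"
  have "[:coeff (coeff F (fst s)) (snd s):] = 0" if s: "s \<in> I" for s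
  proof (rule skolem_mahler_lech_nondegenerate[where I = I and \<beta> = "\<lambda>s. a ^ fst s * b ^ snd s"
        and P = "\<lambda>s. [:coeff (coeff F (fst s)) (snd s):]" and i = s])
    have "poly2 F (a ^ n) (b ^ n) =
      (\<Sum>s\<in>I. poly [:coeff (coeff F (fst s)) (snd s):] (of_nat n) * (a ^ fst s * b ^ snd s) ^ n)" for n
      unfolding poly2_sum2 I_def
      by (intro sum.cong refl) (auto simp: power_mult_distrib mult.commute simp flip: power_mult)
    with inf show "infinite {n. (\<Sum>s\<in>I. poly [:coeff (coeff F (fst s)) (snd s):] (of_nat n) *
      (a ^ fst s * b ^ snd s) ^ n) = 0}" by simp
    show "s = t" if "k > 0" "(a ^ fst s * b ^ snd s) ^ k = (a ^ fst t * b ^ snd t) ^ k" for s t k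
      using indep[of "fst s * k" "snd s * k" "fst t * k" "snd t * k"] that
      by (simp add: power_mult_distrib prod_eq_iff flip: power_mult)
  qed (use nz s in \<open>auto simp: I_def\<close>)
  then show ?thesis unfolding poly2_sum2 I_def[symmetric] by (intro sum.neutral) auto
qed

text \<open>Here the bases are the powers of \<open>a\<close>, with coefficients polynomial in
  \<open>n\<close>.\<close>

lemma poly2_eq_0_if_not_root_of_unity:
  fixes a :: "'a::field_char_0"
  assumes nz: "a \<noteq> 0" and tors: "\<And>k. k > 0 \<Longrightarrow> a ^ k \<noteq> 1"
    and inf: "infinite {n. poly2 F (a ^ n) (of_nat n) = 0}"
  shows "poly2 F u v = 0"
proof -
  have inj: "i = j" if "a ^ i = a ^ j" for i j
  proof (rule ccontr)
    assume "i \<noteq> j"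
    then consider "i < j" | "j < i" by linarith
    then show False
    proof cases
      case 1
      then have "a ^ j = a ^ i * a ^ (j - i)" by (simp flip: power_add)
      then show False using that nz tors[of "j - i"] 1 by simp
    next
      case 2
      then have "a ^ i = a ^ j * a ^ (i - j)" by (simp flip: power_add)
      then show False using that nz tors[of "i - j"] 2 by simp
    qed
  qed
  have "coeff F i = 0" if "i \<in> {..degree F}" for i
  proof (rule skolem_mahler_lech_nondegenerate[where I = "{..degree F}" and \<beta> = "\<lambda>i. a ^ i" and i = i])
    have "poly2 F (a ^ n) (of_nat n) = (\<Sum>i\<le>degree F. poly (coeff F i) (of_nat n) * (a ^ i) ^ n)" for n
      by (simp add: poly2_sum1 mult.commute flip: power_mult)
    with inf show "infinite {n. (\<Sum>i\<le>degree F. poly (coeff F i) (of_nat n) * (a ^ i) ^ n) = 0}" by simp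
    show "i = j" if "k > 0" "(a ^ i) ^ k = (a ^ j) ^ k" for i j k
      using inj[of "i * k" "j * k"] that by (simp flip: power_mult)
  qed (use nz that in auto)
  then show ?thesis by (simp add: poly2_sum1)
qed

section \<open>Independent multipliers, and translations\<close>

lemma finite_common_independent:
  fixes a b p q :: "'a::field_char_0"
  assumes nz: "a \<noteq> 0" "b \<noteq> 0" and "p \<noteq> q"
    and indep: "\<And>i j i' j'. a ^ i * b ^ j = a ^ i' * b ^ j' \<Longrightarrow> i = i' \<and> j = j'"
  shows "finite {x. \<exists>n>0. a ^ n * (x - p) + p = poly c x \<and> b ^ n * (x - q) + q = poly c x}" (is "finite ?S")
proof (rule ccontr)
  assume inf: "infinite ?S"
  define C :: "'a \<Rightarrow> 'a poly poly" where "C k = [:[:k:]:]" for k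
  define U V :: "'a poly poly" where "U = [:0, 1:]" and "V = [:[:0, 1:]:]"
  \<comment> \<open>For u = a^n and v = b^n, equating the two values gives x = W / D;
    \<open>F\<close> is D^(degree c + 1) times c(x) - (u (x - p) + p).\<close>
  define D where "D = U - V"
  define W where "W = C p * (U - 1) - C q * (V - 1)"
  define F where "F = homogenize c W D * D - D ^ degree c * (U * (W - C p * D) + C p * D)"
  have ev: "poly2 D u v = u - v" "poly2 W u v = p * (u - 1) - q * (v - 1)"
    "poly2 U u v = u" "poly2 (C k) u v = k" for u v k
    unfolding D_def W_def C_def U_def V_def poly2_simps by simp_all
  have F: "poly2 F u v = 0 \<longleftrightarrow> poly c x = u * (x - p) + p"
    if "u \<noteq> v" "(u - v) * x = p * (u - 1) - q * (v - 1)" for u v x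
  proof -
    have x: "x = (p * (u - 1) - q * (v - 1)) / (u - v)" using that by (simp add: field_simps)
    have "poly2 F u v = (u - v) ^ degree c * poly c x * (u - v)
      - (u - v) ^ degree c * (u * ((u - v) * x - p * (u - v)) + p * (u - v))"
      using that by (simp add: F_def ev poly2_homogenize flip: x)
    also have "\<dots> = (u - v) ^ degree c * (u - v) * (poly c x - (u * (x - p) + p))"
      by (simp add: algebra_simps)
    finally show ?thesis using that by simp
  qed
  define g where "g n = (p * (a ^ n - 1) - q * (b ^ n - 1)) / (a ^ n - b ^ n)" for n
  have "?S \<subseteq> g ` {n. poly2 F (a ^ n) (b ^ n) = 0}"
  proof
    fix x assume "x \<in> ?S"
    then obtain n where n: "n > 0" "a ^ n * (x - p) + p = poly c x" "b ^ n * (x - q) + q = poly c x" by auto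
    have ne: "a ^ n \<noteq> b ^ n" using indep[of n 0 0 n] n(1) by auto
    have "a ^ n * (x - p) + p = b ^ n * (x - q) + q" using n(2,3) by simp
    then have eq: "(a ^ n - b ^ n) * x = p * (a ^ n - 1) - q * (b ^ n - 1)"
      by (simp add: algebra_simps)
    then have "x = g n" using ne by (simp add: g_def field_simps)
    moreover have "poly2 F (a ^ n) (b ^ n) = 0" using F[OF ne eq] n(2) by simp
    ultimately show "x \<in> g ` {n. poly2 F (a ^ n) (b ^ n) = 0}" by blast
  qed
  then have "infinite {n. poly2 F (a ^ n) (b ^ n) = 0}" using inf finite_surj by blast
  then have zero: "poly2 F u v = 0" for u v
    using poly2_eq_0_if_independent[of a b F u v] nz indep by blast
  \<comment> \<open>two points \<open>(u, v)\<close> on the same line through \<open>(1, 1)\<close>, so with the same \<open>x\<close>\<close>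
  define x where "x = 2 * p - q"
  have "poly c x = 3 * (x - p) + p" "poly c x = 5 * (x - p) + p"
    using F[of 3 2 x] F[of 5 3 x] zero by (simp_all add: x_def algebra_simps)
  then show False using \<open>p \<noteq> q\<close> by (simp add: x_def)
qed

lemma finite_common_translation:
  fixes a b q :: "'a::field_char_0"
  assumes nz: "a \<noteq> 0" "b \<noteq> 0" and tors: "\<And>k. k > 0 \<Longrightarrow> a ^ k \<noteq> 1"
  shows "finite {x. \<exists>n>0. x + of_nat n * b = poly c x \<and> a ^ n * (x - q) + q = poly c x}" (is "finite ?S")
proof (rule ccontr)
  assume inf: "infinite ?S"
  define C :: "'a \<Rightarrow> 'a poly poly" where "C k = [:[:k:]:]" for k
  define U V :: "'a poly poly" where "U = [:0, 1:]" and "V = [:[:0, 1:]:]"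
  \<comment> \<open>For u = a^n and v = n, equating the two values gives x = W / D; \<open>F\<close>
    is D^(degree c + 1) times c(x) - (x + b v).\<close>
  define D where "D = U - 1"
  define W where "W = C q * D + C b * V"
  define F where "F = homogenize c W D * D - D ^ degree c * (W + C b * V * D)"
  have ev: "poly2 D u v = u - 1" "poly2 W u v = q * (u - 1) + b * v"
    "poly2 V u v = v" "poly2 (C k) u v = k" for u v k
    unfolding D_def W_def C_def U_def V_def poly2_simps by simp_all
  have F: "poly2 F u v = 0 \<longleftrightarrow> poly c x = x + b * v"
    if "u \<noteq> 1" "(u - 1) * x = q * (u - 1) + b * v" for u v x
  proof -
    have x: "x = (q * (u - 1) + b * v) / (u - 1)" using that by (simp add: field_simps)
    have "poly2 F u v = (u - 1) ^ degree c * poly c x * (u - 1)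
      - (u - 1) ^ degree c * ((u - 1) * x + b * v * (u - 1))"
      using that by (simp add: F_def ev poly2_homogenize flip: x)
    also have "\<dots> = (u - 1) ^ degree c * (u - 1) * (poly c x - (x + b * v))"
      by (simp add: algebra_simps)
    finally show ?thesis using that by simp
  qed
  define g where "g n = (q * (a ^ n - 1) + b * of_nat n) / (a ^ n - 1)" for n
  have "?S \<subseteq> g ` {n. poly2 F (a ^ n) (of_nat n) = 0}"
  proof
    fix x assume "x \<in> ?S"
    then obtain n where n: "n > 0" "x + of_nat n * b = poly c x" "a ^ n * (x - q) + q = poly c x" by auto
    have ne: "a ^ n \<noteq> 1" using tors n(1) by blast
    have "x + of_nat n * b = a ^ n * (x - q) + q" using n(2,3) by simp
    then have eq: "(a ^ n - 1) * x = q * (a ^ n - 1) + b * of_nat n"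
      by (simp add: algebra_simps)
    then have "x = g n" using ne by (simp add: g_def field_simps)
    moreover have "poly2 F (a ^ n) (of_nat n) = 0" using F[OF ne eq] n(2) by (simp add: mult.commute)
    ultimately show "x \<in> g ` {n. poly2 F (a ^ n) (of_nat n) = 0}" by blast
  qed
  then have "infinite {n. poly2 F (a ^ n) (of_nat n) = 0}" using inf finite_surj by blast
  then have zero: "poly2 F u v = 0" for u v
    using poly2_eq_0_if_not_root_of_unity[of a F u v] nz(1) tors by blast
  \<comment> \<open>At this point the relation between u, v and x reads v = u - 1, so (2, 1) and (3,
    2) give two different values of c(x).\<close>
  define x where "x = q + b"
  have "poly c x = x + b * 1" "poly c x = x + b * 2"
    using F[of 2 x 1] F[of 3 x 2] zero by (simp_all add: x_def algebra_simps)
  then show False using nz(2) by simp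
qed

section \<open>Dependent multipliers\<close>

lemma poly_eqI_infinite:
  fixes P Q :: "'a::idom poly"
  assumes "infinite S" "\<And>x. x \<in> S \<Longrightarrow> poly P x = poly Q x"
  shows "P = Q"
proof (rule ccontr)
  assume "P \<noteq> Q"
  then have "finite {x. poly (P - Q) x = 0}" by (intro poly_roots_finite) simp
  moreover have "S \<subseteq> {x. poly (P - Q) x = 0}" using assms(2) by auto
  ultimately show False using assms(1) finite_subset by blast
qed

lemma degree_le_1_eq:
  assumes "degree c \<le> 1"
  shows "c = [:coeff c 0, coeff c 1:]"
  using assms by (intro poly_eqI) (auto simp: coeff_pCons coeff_eq_0 split: nat.splits)

lemma linear_eq_id:
  fixes c :: "'a::field poly"
  assumes "degree c \<le> 1" "poly c p = p" "poly c q = q" "p \<noteq> q"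
  shows "poly c x = x"
proof -
  define s t where "s = coeff c 0" and "t = coeff c 1"
  have c: "c = [:s, t:]" using degree_le_1_eq[OF assms(1)] by (simp add: s_def t_def)
  have eqs: "s + p * t = p" "s + q * t = q" using assms(2,3) by (simp_all add: c)
  then have "p * t - q * t = p - q" by (metis add_diff_cancel_left)
  then have "(p - q) * (t - 1) = 0" by (simp add: algebra_simps)
  then have "t = 1" using assms(4) by simp
  then show ?thesis using eqs by (simp add: c)
qed

text \<open>Raising c(x) - p = a^n (x - p) to the power i and c(x) - q = b^n (x - q) to the power j
  eliminates n. As c - p and c - q are coprime, (c - p)^i divides (x - p)^i; so \<open>c\<close> has
  degree at most 1 and fixes p and q. Hence c = x, and only x = p can be a common value.\<close>

lemma finite_common_dependent:
  fixes a b p q :: complex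
  assumes "p \<noteq> q" and tors: "\<And>k. k > 0 \<Longrightarrow> a ^ k \<noteq> 1"
    and dep: "a ^ i = b ^ j" "i > 0" "j > 0"
  shows "finite {x. \<exists>n>0. a ^ n * (x - p) + p = poly c x \<and> b ^ n * (x - q) + q = poly c x}" (is "finite ?S")
proof (rule ccontr)
  assume inf: "infinite ?S"
  have eq: "(c - [:p:]) ^ i * [:- q, 1:] ^ j = (c - [:q:]) ^ j * [:- p, 1:] ^ i"
  proof (rule poly_eqI_infinite[OF inf])
    fix x assume "x \<in> ?S"
    then obtain n where n: "a ^ n * (x - p) + p = poly c x" "b ^ n * (x - q) + q = poly c x" by blast
    have "(a ^ n) ^ i = (b ^ n) ^ j" using dep(1) by (metis mult.commute power_mult)
    moreover have "poly c x - p = a ^ n * (x - p)" by (simp flip: n(1))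
    moreover have "poly c x - q = b ^ n * (x - q)" by (simp flip: n(2))
    ultimately show "poly ((c - [:p:]) ^ i * [:- q, 1:] ^ j) x = poly ((c - [:q:]) ^ j * [:- p, 1:] ^ i) x"
      by (simp add: power_mult_distrib)
  qed
  \<comment> \<open>At \<open>p\<close> the right side of \<open>eq\<close> vanishes, while (p -
    q)^j on the left is nonzero.\<close>
  have cp: "poly c p = p" using arg_cong[OF eq, of "\<lambda>r. poly r p"] dep assms(1)
    by (simp add: power_0_left)
  have cq: "poly c q = q" using arg_cong[OF eq, of "\<lambda>r. poly r q"] dep assms(1)
    by (simp add: power_0_left)
  have "coprime (c - [:p:]) (c - [:q:])"
  proof (rule coprimeI)
    fix d assume "d dvd c - [:p:]" "d dvd c - [:q:]"
    then have "d dvd (c - [:p:]) - (c - [:q:])" by (rule dvd_diff)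
    then have "d dvd [:q - p:]" by simp
    moreover have "is_unit [:q - p:]" using assms(1) by (simp add: is_unit_const_poly_iff dvd_field_iff)
    ultimately show "is_unit d" by (rule dvd_unit_imp_unit)
  qed
  moreover have "(c - [:p:]) ^ i dvd (c - [:q:]) ^ j * [:- p, 1:] ^ i" by (simp flip: eq)
  ultimately have dvd: "(c - [:p:]) ^ i dvd [:- p, 1:] ^ i"
    by (simp add: coprime_dvd_mult_right_iff)
  then have "degree ((c - [:p:]) ^ i) \<le> degree ([:- p, 1:] ^ i)"
    by (rule dvd_imp_degree_le) simp
  moreover have "c - [:p:] \<noteq> 0" using dvd dep(2) by (auto simp: power_0_left)
  ultimately have "degree (c - [:p:]) \<le> 1" using dep(2) by (simp add: degree_power_eq)
  then have "degree (c - [:p:] + [:p:]) \<le> 1" by (intro degree_add_le) auto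
  then have "degree c \<le> 1" by simp
  then have c: "poly c x = x" for x using linear_eq_id cp cq assms(1) by blast
  have "?S \<subseteq> {p}"
  proof
    fix x assume "x \<in> ?S"
    then obtain n where n: "n > 0" "a ^ n * (x - p) + p = x" by (auto simp: c)
    then have "(a ^ n - 1) * (x - p) = 0" by (simp add: algebra_simps)
    then show "x \<in> {p}" using tors[OF n(1)] by simp
  qed
  then show False using inf finite_subset by blast
qed

text \<open>
  The exception is genuine: for \<open>c = p + q - x\<close> and \<open>b = 1 / a\<close> there are infinitely many common
  values, and only the freeness of the semigroup excludes this case.
\<close>

lemma infinite_common_inverse_dependent:
  fixes a b p q :: complex
  assumes "p \<noteq> q" and tors: "\<And>k. k > 0 \<Longrightarrow> a ^ k \<noteq> 1"
    and dep: "a ^ i * b ^ j = 1" "i > 0" "j > 0"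
    and inf: "infinite {x. \<exists>n>0. a ^ n * (x - p) + p = poly c x \<and> b ^ n * (x - q) + q = poly c x}" (is "infinite ?S")
  shows "i = j"
proof -
  have eq: "(c - [:p:]) ^ i * (c - [:q:]) ^ j = [:- p, 1:] ^ i * [:- q, 1:] ^ j"
  proof (rule poly_eqI_infinite[OF inf])
    fix x assume "x \<in> ?S"
    then obtain n where n: "a ^ n * (x - p) + p = poly c x" "b ^ n * (x - q) + q = poly c x" by blast
    have "(a ^ n) ^ i * (b ^ n) ^ j = (a ^ i * b ^ j) ^ n"
      by (simp add: power_mult_distrib mult.commute flip: power_mult)
    then have "(a ^ n) ^ i * (b ^ n) ^ j = 1" using dep(1) by simp
    moreover have "poly c x - p = a ^ n * (x - p)" by (simp flip: n(1))
    moreover have "poly c x - q = b ^ n * (x - q)" by (simp flip: n(2))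
    ultimately show "poly ((c - [:p:]) ^ i * (c - [:q:]) ^ j) x = poly ([:- p, 1:] ^ i * [:- q, 1:] ^ j) x"
      by (simp add: power_mult_distrib)
  qed
  have deg: "degree (c - [:k:]) = degree c" for k
  proof (cases "degree c = 0")
    case True
    then show ?thesis by (metis degree_0 degree_diff_le degree_pCons_0 le_zero_eq)
  next
    case False
    then show ?thesis using degree_add_eq_left[of "- [:k:]" c] by (simp del: minus_pCons)
  qed
  have nz: "c - [:p:] \<noteq> 0" "c - [:q:] \<noteq> 0" using eq dep by (auto simp: power_0_left)
  have "degree c * i + degree c * j = i + j"
    using arg_cong[OF eq, of degree] nz by (simp add: degree_mult_eq degree_power_eq deg mult.commute)
  then have "degree c * (i + j) = 1 * (i + j)" by (simp add: algebra_simps)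
  then have c1: "degree c = 1" using dep by simp
  \<comment> \<open>By evaluation of \<open>eq\<close>, \<open>c\<close> maps p and q into {p, q};
    being injective, it fixes or swaps them. Fixing both means c = x, with p as the only possible
    common value.\<close>
  have cp: "poly c p = p \<or> poly c p = q"
    using arg_cong[OF eq, of "\<lambda>r. poly r p"] dep
    by (simp add: power_0_left)
  have cq: "poly c q = p \<or> poly c q = q"
    using arg_cong[OF eq, of "\<lambda>r. poly r q"] dep
    by (simp add: power_0_left)
  define s t where "s = coeff c 0" and "t = coeff c 1"
  have c: "c = [:s, t:]" using degree_le_1_eq[of c] c1 by (simp add: s_def t_def)
  have t0: "t \<noteq> 0" using c1 by (auto simp: c split: if_splits)
  have inj: "poly c p \<noteq> poly c q" using t0 assms(1) by (simp add: c)
  have "\<not> (poly c p = p \<and> poly c q = q)"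
  proof
    assume *: "poly c p = p \<and> poly c q = q"
    have cid: "poly c x = x" for x using linear_eq_id[of c p q] * c1 assms(1) by simp
    have "?S \<subseteq> {p}"
    proof
      fix x assume "x \<in> ?S"
      then obtain n where n: "n > 0" "a ^ n * (x - p) + p = x" by (auto simp: cid)
      then have "(a ^ n - 1) * (x - p) = 0" by (simp add: algebra_simps)
      then show "x \<in> {p}" using tors[OF n(1)] by simp
    qed
    then show False using inf finite_subset by blast
  qed
  then have swap: "poly c p = q" "poly c q = p" using cp cq inj by auto
  then have eqs: "s + p * t = q" "s + q * t = p" by (simp_all add: c)
  then have "p * t - q * t = q - p" by (metis add_diff_cancel_left)
  then have "(p - q) * (t + 1) = 0" by (simp add: algebra_simps)
  then have t: "t = -1" using assms(1) by (simp add: eq_neg_iff_add_eq_0)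
  then have s: "s = p + q" using eqs by (simp add: algebra_simps)
  \<comment> \<open>For c = p + q - x the identity exchanges, up to sign, the exponents of x - p and
    x - q; multiplicities at \<open>p\<close> give i = j.\<close>
  have lin: "c - [:p:] = smult (-1) [:- q, 1:]" "c - [:q:] = smult (-1) [:- p, 1:]"
    by (simp_all add: c s t)
  have eq': "smult ((-1) ^ i * (-1) ^ j) ([:- q, 1:] ^ i * [:- p, 1:] ^ j) = [:- p, 1:] ^ i * [:- q, 1:] ^ j"
    using eq unfolding lin smult_power
    by (simp only: mult_smult_left mult_smult_right smult_smult mult.commute)
  have ord: "order p ([:- q, 1:] ^ n) = 0" for n using assms(1) by (intro order_0I) simp
  have "order p ([:- q, 1:] ^ i * [:- p, 1:] ^ j) = j"
    by (subst order_mult) (simp_all add: ord order_power_n_n del: mult_pCons_left)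
  moreover have "order p ([:- p, 1:] ^ i * [:- q, 1:] ^ j) = i"
    by (subst order_mult) (simp_all add: ord order_power_n_n del: mult_pCons_left)
  ultimately show ?thesis
    using arg_cong[OF eq', of "order p"] by (subst (asm) order_smult) simp_all
qed

section \<open>Iterates of linear polynomials\<close>

lemma comp_independentD:
  "comp_independent f g \<Longrightarrow> v \<noteq> [] \<Longrightarrow> w \<noteq> [] \<Longrightarrow> word_comp f g v = word_comp f g w \<Longrightarrow> v = w"
  by (simp add: comp_independent_def inj_on_def)

lemma comp_independent_swap:
  assumes "comp_independent f g"
  shows "comp_independent g f"
proof -
  have eq: "word_comp g f w = word_comp f g (map Not w)" for w
    by (induction w) auto
  show ?thesis
    unfolding comp_independent_def
  proof (rule inj_onI)
    fix v w :: "bool list"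
    assume "v \<in> {w. w \<noteq> []}" "w \<in> {w. w \<noteq> []}" "word_comp g f v = word_comp g f w"
    then have "map Not v = map Not w"
      by (intro comp_independentD[OF assms]) (simp_all add: eq)
    then show "v = w" by (simp add: inj_map_eq_map inj_def)
  qed
qed

text \<open>A letter is appended because the empty word is not in the free semigroup: the words
  compared are f^(n+1) and f.\<close>

lemma comp_independent_not_torsion:
  assumes "comp_independent f g" "n > 0"
  shows "poly_iter f n \<noteq> [:0, 1:]"
proof
  assume "poly_iter f n = [:0, 1:]"
  then have "word_comp f g (replicate n True @ [True]) = word_comp f g [True]"
    by (simp add: word_comp_append word_comp_replicate)
  then have "replicate n True @ [True] = [True]"
    by (intro comp_independentD[OF assms(1)]) auto
  then show False using assms(2) by simp
qed

text \<open>The two sides are distinct words. This rules out two translations, a common fixed point,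
  and multipliers with a^n b^n = 1.\<close>

lemma comp_independent_not_commute:
  assumes "comp_independent f g" "n > 0"
  shows "pcompose (pcompose (poly_iter f n) (poly_iter g n)) (pcompose (poly_iter g n) (poly_iter f n)) \<noteq>
    pcompose (pcompose (poly_iter g n) (poly_iter f n)) (pcompose (poly_iter f n) (poly_iter g n))"
proof
  let ?F = "replicate n True" and ?G = "replicate n False"
  assume "pcompose (pcompose (poly_iter f n) (poly_iter g n)) (pcompose (poly_iter g n) (poly_iter f n)) =
    pcompose (pcompose (poly_iter g n) (poly_iter f n)) (pcompose (poly_iter f n) (poly_iter g n))"
  then have "word_comp f g (?F @ ?G @ ?G @ ?F) = word_comp f g (?G @ ?F @ ?F @ ?G)"
    by (simp add: word_comp_append word_comp_replicate pcompose_assoc)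
  then have "?F @ ?G @ ?G @ ?F = ?G @ ?F @ ?F @ ?G"
    using assms(2) by (intro comp_independentD[OF assms(1)]) auto
  then show False using assms(2) by (cases n) auto
qed

lemma poly_iter_fixpoint:
  "poly_iter [:p - a * p, a:] n = [:p - a ^ n * p, a ^ n :: 'a::comm_ring_1:]"
  by (induction n) (simp_all add: poly_iter_def pcompose_pCons algebra_simps)

lemma poly_iter_translation:
  "poly_iter [:b, 1:] n = [:of_nat n * b, 1 :: 'a::comm_ring_1:]"
  by (induction n) (simp_all add: poly_iter_def pcompose_pCons algebra_simps)

section \<open>Finiteness of the common values\<close>

lemma finite_common_values:
  fixes f g c :: "complex poly"
  assumes f: "degree f = 1" and g: "degree g = 1" and ind: "comp_independent f g"
  shows "finite {x. \<exists>n>0. poly (poly_iter f n) x = poly c x \<and> poly (poly_iter g n) x = poly c x}"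
proof -
  have one: "\<exists>a b. h = [:b, a:] \<and> a \<noteq> 0" if "degree h = 1" for h :: "complex poly"
    using degree_le_1_eq[of h] that by (metis degree_pCons_0 le_refl zero_neq_one pCons_0_0)
  obtain a b\<^sub>0 where fa: "f = [:b\<^sub>0, a:]" "a \<noteq> 0" using one[OF f] by blast
  obtain b b\<^sub>1 where gb: "g = [:b\<^sub>1, b:]" "b \<noteq> 0" using one[OF g] by blast
  \<comment> \<open>The fixed point of t X + s is s / (1 - t).\<close>
  have fix_form: "\<exists>p. [:s, t:] = [:p - t * p, t:]" if "t \<noteq> 1" for s t :: complex
  proof -
    have "s = (1 - t) * (s / (1 - t))" using that by simp
    then have "s = s / (1 - t) - t * (s / (1 - t))" by (simp only: left_diff_distrib mult_1)
    then show ?thesis by (intro exI[of _ "s / (1 - t)"]) simp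
  qed
  have tors: "t ^ k \<noteq> 1" if "comp_independent [:q - t * q, t:] h" "k > 0" for q t k and h :: "complex poly"
    using comp_independent_not_torsion[OF that] by (auto simp: poly_iter_fixpoint)
  \<comment> \<open>Only the unordered pair is prescribed, so either of \<open>f\<close> and
    \<open>g\<close> may be the translation.\<close>
  have translation: ?thesis if "f' = [:s, 1:]" "g' = [:q - t * q, t:]" "t \<noteq> 0" "comp_independent f' g'"
    "{f', g'} = {f, g}" for f' g' s t q
  proof -
    have "s \<noteq> 0" using comp_independent_not_torsion[OF that(4), of 1] that(1) by (auto simp: poly_iter_translation)
    moreover have "t ^ k \<noteq> 1" if "k > 0" for k
      using tors comp_independent_swap[OF \<open>comp_independent f' g'\<close>] \<open>g' = _\<close> that by blast
    ultimately have "finite {x. \<exists>n>0. x + of_nat n * s = poly c x \<and> t ^ n * (x - q) + q = poly c x}"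
      using \<open>t \<noteq> 0\<close> by (intro finite_common_translation)
    moreover have "poly (poly_iter f' n) x = x + of_nat n * s" "poly (poly_iter g' n) x = t ^ n * (x - q) + q" for n x
      unfolding that(1,2) poly_iter_translation poly_iter_fixpoint by (simp_all add: algebra_simps)
    ultimately have "finite {x. \<exists>n>0. poly (poly_iter f' n) x = poly c x \<and> poly (poly_iter g' n) x = poly c x}"
      by simp
    then show ?thesis using that(5) by (auto simp: doubleton_eq_iff conj_commute)
  qed
  consider "a = 1" "b = 1" | "a = 1" "b \<noteq> 1" | "a \<noteq> 1" "b = 1" | "a \<noteq> 1" "b \<noteq> 1" by blast
  then show ?thesis
  proof cases
    case 1
    then show ?thesis using comp_independent_not_commute[OF ind, of 1]
      by (simp add: fa gb poly_iter_def pcompose_pCons)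
  next
    case 2
    then obtain q where "g = [:q - b * q, b:]" using fix_form gb(1) by metis
    then show ?thesis using translation[of f b\<^sub>0 g q b] fa(1) 2 gb(2) ind by simp
  next
    case 3
    then obtain q where "f = [:q - a * q, a:]" using fix_form fa(1) by metis
    then show ?thesis
      using translation[of g b\<^sub>1 f q a] gb(1) 3 fa(2) comp_independent_swap[OF ind] by (simp add: insert_commute)
  next
    case 4
    obtain p where p: "f = [:p - a * p, a:]" using fix_form 4 fa(1) by metis
    obtain q where q: "g = [:q - b * q, b:]" using fix_form 4 gb(1) by metis
    have ta: "a ^ k \<noteq> 1" if "k > 0" for k using tors[of p a g k] ind that by (simp add: p)
    have tb: "b ^ k \<noteq> 1" if "k > 0" for k using tors[of q b f k] comp_independent_swap[OF ind] that by (simp add: q)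
    \<comment> \<open>Linear maps with a common fixed point commute.\<close>
    have "p \<noteq> q"
    proof
      assume "p = q"
      then show False using comp_independent_not_commute[OF ind, of 1]
        by (simp add: p q poly_iter_def pcompose_pCons algebra_simps)
    qed
    let ?S = "{x. \<exists>n>0. a ^ n * (x - p) + p = poly c x \<and> b ^ n * (x - q) + q = poly c x}"
    let ?indep = "\<forall>i j i' j'. a ^ i * b ^ j = a ^ i' * b ^ j' \<longrightarrow> i = i' \<and> j = j'"
    \<comment> \<open>No positive power of \<open>a\<close> or \<open>b\<close> is 1, so one
      positive exponent forces the other to be positive.\<close>
    have pos: "a ^ i = b ^ j \<Longrightarrow> i > 0 \<Longrightarrow> j > 0" "a ^ i = b ^ j \<Longrightarrow> j > 0 \<Longrightarrow> i > 0" for i j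
      using ta[of i] tb[of j] by (auto intro: Nat.gr0I)
    have pos': "a ^ i * b ^ j = 1 \<Longrightarrow> i > 0 \<Longrightarrow> j > 0" "a ^ i * b ^ j = 1 \<Longrightarrow> j > 0 \<Longrightarrow> i > 0" for i j
      using ta[of i] tb[of j] by (auto intro: Nat.gr0I)
    have pow_diff: "t ^ m = t ^ k * t ^ (m - k)" if "k \<le> m" for t :: complex and m k :: nat
      using that by (simp flip: power_add)
    \<comment> \<open>Cancelling the smaller powers leaves a^i b^j = 1 if both larger exponents are
      on the same side, and a^i = b^j otherwise; by symmetry \<open>i \<le> i'\<close>.\<close>
    have dep: "(\<exists>i>0. \<exists>j>0. a ^ i = b ^ j) \<or> (\<exists>i>0. \<exists>j>0. a ^ i * b ^ j = 1)" if not: "\<not> ?indep"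
    proof -
      have one_dir: ?thesis if eq: "a ^ i * b ^ j = a ^ i' * b ^ j'" and le: "i \<le> i'" and ne: "\<not> (i = i' \<and> j = j')" for i j i' j'
      proof (cases "j \<le> j'")
        case True
        then have "a ^ (i' - i) * b ^ (j' - j) = 1"
          using eq fa(2) gb(2) by (simp add: pow_diff[OF le] pow_diff[OF True])
        then show ?thesis using pos'[of "i' - i" "j' - j"] ne le True by (metis diff_is_0_eq' le_antisym not_gr_zero zero_less_diff nat_less_le)
      next
        case False
        then have le': "j' \<le> j" by simp
        have "a ^ (i' - i) = b ^ (j - j')"
          using eq fa(2) gb(2) by (simp add: pow_diff[OF le] pow_diff[OF le'])
        moreover have "j - j' > 0" using False by simp
        ultimately show ?thesis using pos(2) by blast
      qed
      obtain i j i' j' where *: "a ^ i * b ^ j = a ^ i' * b ^ j'" "\<not> (i = i' \<and> j = j')" using not by blast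
      show ?thesis
        using one_dir[of i j i' j'] one_dir[of i' j' i j] * by (metis nat_le_linear)
    qed
    have "finite ?S"
    proof (rule ccontr)
      assume inf: "infinite ?S"
      have "\<not> ?indep" using finite_common_independent[OF fa(2) gb(2) \<open>p \<noteq> q\<close>, of c] inf by blast
      then consider i j where "i > 0" "j > 0" "a ^ i = b ^ j" | i j where "i > 0" "j > 0" "a ^ i * b ^ j = 1"
        using dep by blast
      then show False
      proof cases
        case 1
        then show False using finite_common_dependent[OF \<open>p \<noteq> q\<close> ta, of i b j c] inf by blast
      next
        case 2
        then have "i = j" using infinite_common_inverse_dependent[OF \<open>p \<noteq> q\<close> ta, of i b j c] inf by blast
        then have "a ^ i * b ^ i = 1" using 2 by simp
        \<comment> \<open>f^i g^i and g^i f^i have leading coefficient a^i b^i = 1, so they are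
          translations and commute.\<close>
        then show False using comp_independent_not_commute[OF ind 2(1)]
          by (simp add: p q poly_iter_fixpoint pcompose_pCons algebra_simps)
      qed
    qed
    moreover have "poly (poly_iter f n) x = a ^ n * (x - p) + p" "poly (poly_iter g n) x = b ^ n * (x - q) + q" for n x
      by (simp_all add: p q poly_iter_fixpoint algebra_simps)
    ultimately show ?thesis by simp
  qed
qed

section \<open>The bound for the gcd\<close>

text \<open>\<open>h \<noteq> 0\<close> is part of the claim because every polynomial divides
  0.\<close>

theorem theorem0p2:
  fixes f g c :: "complex poly"
  assumes "degree f = 1" and "degree g = 1"
    and "comp_independent f g"
  shows "\<exists>h :: complex poly. h \<noteq> 0 \<and>
    (\<forall>n::nat. n > 0 \<longrightarrow> gcd (poly_iter f n - c) (poly_iter g n - c) dvd h)"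
proof -
  define S where "S = {x. \<exists>n>0. poly (poly_iter f n) x = poly c x \<and> poly (poly_iter g n) x = poly c x}"
  have S: "finite S" using finite_common_values[OF assms] by (simp add: S_def)
  \<comment> \<open>Simple factors suffice: each gcd has degree at most 1, and its root, if any,
    lies in \<open>S\<close>.\<close>
  define h where "h = (\<Prod>x\<in>S. [:- x, 1:])"
  have deg: "degree (poly_iter k n) \<le> 1" if "degree k = 1" for k :: "complex poly" and n
    by (induction n) (use that in \<open>simp_all add: poly_iter_def degree_pcompose\<close>)
  have "gcd (poly_iter f n - c) (poly_iter g n - c) dvd h" if n: "n > 0" for n
  proof -
    define G where "G = gcd (poly_iter f n - c) (poly_iter g n - c)"
    have "poly_iter f n \<noteq> poly_iter g n"
    proof
      assume "poly_iter f n = poly_iter g n"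
      then have "word_comp f g (replicate n True) = word_comp f g (replicate n False)"
        by (simp add: word_comp_replicate)
      then show False using comp_independentD[OF assms(3), of "replicate n True" "replicate n False"] n
        by (cases n) auto
    qed
    moreover have "G dvd (poly_iter f n - c) - (poly_iter g n - c)" unfolding G_def by (rule dvd_diff[OF gcd_dvd1 gcd_dvd2])
    ultimately have "degree G \<le> degree (poly_iter f n - poly_iter g n)" "G \<noteq> 0"
      by (auto intro: dvd_imp_degree_le)
    moreover have "degree (poly_iter f n - poly_iter g n) \<le> 1"
      using deg assms by (intro degree_diff_le)
    ultimately consider "degree G = 0" | "degree G = 1" by linarith
    then show ?thesis
    proof cases
      case 1
      then have "is_unit G" using \<open>G \<noteq> 0\<close> by (simp add: is_unit_iff_degree)
      then show ?thesis unfolding G_def by (rule unit_imp_dvd)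
    next
      case 2
      define s t where "s = coeff G 0" and "t = coeff G 1"
      have G: "G = [:s, t:]" using degree_le_1_eq[of G] 2 by (simp add: s_def t_def)
      have "t \<noteq> 0" using 2 by (auto simp: G split: if_splits)
      define x where "x = - s / t"
      have Gx: "G = smult t [:- x, 1:]" using \<open>t \<noteq> 0\<close> by (simp add: G x_def)
      have "[:- x, 1:] dvd G" unfolding Gx by (rule dvd_smult) (rule dvd_refl)
      then have "[:- x, 1:] dvd poly_iter f n - c" "[:- x, 1:] dvd poly_iter g n - c"
        unfolding G_def by (auto elim: dvd_trans)
      then have "x \<in> S" using n by (auto simp: S_def simp flip: poly_eq_0_iff_dvd)
      then have "[:- x, 1:] dvd h" unfolding h_def using S by (rule dvd_prodI[rotated])
      then show ?thesis using \<open>t \<noteq> 0\<close> unfolding G_def[symmetric] Gx by (rule smult_dvd)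
    qed
  qed
  moreover have "h \<noteq> 0" using S by (simp add: h_def)
  ultimately show ?thesis by blast
qed

end
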